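(* Let $\mathcal{H}_1=\mathbb{R}^{(N+1)K}$, $\mathcal{H}_2=\mathbb{R}^{KM}$, $\mathcal{H}_3=\mathbb{R}^{K(K-1)N/2}$ and $\mathcal{H}=\mathcal{H}_1\times\mathcal{H}_2\times\mathcal{H}_3\times\mathbb{R}$, with the standard Euclidean inner products and norms. Let $\mathcal{D}$, $\Phi_{\mathcal{D}}$, $\Psi$, $\mathfrak{S}_\star=\operatorname{argmin}\Phi_{\mathcal{D}}(\mathbb{R}^{(N+1)K})$, $\check A_{\mathcal{D}}$ and $T_{\mathrm{DRS}}$ be as defined in the context, and assume $\mathfrak{S}_\star\neq\varnothing$. Write $\operatorname{argmin}\Psi(\mathfrak{S}_\star)$ for the set of minimizers of $\Psi$ over $\mathfrak{S}_\star$. Choose $\Upsilon,\varrho_1>0$ large enough to satisfy $\|\mathbf{x}_i\|\le\Upsilon$ $(i=1,\dots,M)$ and $\operatorname{argmin}\Psi(\mathfrak{S}_\star)\cap \bar B_{\mathcal{H}_1}(0,\varrho_1)\neq\varnothing$. Define the bounded closed convex set $$\mathfrak{B}:=\bar B_{\mathcal{H}_1}(0,\varrho_1)\times\bar B_{\mathcal{H}_2}(0,\varrho_2)\times\bar B_{\mathcal{H}_3}(0,\varrho_3)\times[-\varrho_4,\varrho_4]\subset\mathcal{H},$$ where $\varrho_2:=2\varrho_1\sqrt{KM(\Upsilon^2+1)}$, $\varrho_3:=\varrho_1K(K-1)$, $\varrho_4:=2\varrho_1$. For $1\le r<s\le K$ let $\Omega_{r,s}:\mathcal{H}_1\times\mathcal{H}_2\to\mathbb{R}^N$,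 $((\mathbf{w}_j,b_j)_{j=1}^K,\mathbf{u})\mapsto \mathbf{w}_r-\mathbf{w}_s$, and, writing $\boldsymbol{\omega}=(\boldsymbol{\omega}_{r's'})_{1\le r'<s'\le K}\in\mathcal{H}_3$ with $\boldsymbol{\omega}_{r's'}\in\mathbb{R}^N$, let $$E_{r,s}:=\{(\mathbf{p},\mathbf{u},\boldsymbol{\omega},t)\in\mathcal{H}\mid \|\boldsymbol{\omega}_{rs}\|\le t\},\qquad L_{r,s}:=\{(\mathbf{p},\mathbf{u},\boldsymbol{\omega},t)\in\mathcal{H}\mid \boldsymbol{\omega}_{rs}=\Omega_{r,s}P_{\mathcal{N}(\check A_{\mathcal{D}})}(\mathbf{p},\mathbf{u})\}.$$ Put $$\mathcal{F}:=[\mathrm{Fix}(T_{\mathrm{DRS}})\times\mathcal{H}_3\times\mathbb{R}]\cap\mathfrak{B}\cap\bigcap_{1\le r<s\le K}(E_{r,s}\cap L_{r,s})$$ and let $\Theta:\mathcal{H}\to\mathbb{R}$, $\Theta(\mathbf{p},\mathbf{u},\boldsymbol{\omega},t):=t$. Consider the problem $$(\ast)\qquad \text{minimize } \Theta(\mathbf{p},\mathbf{u},\boldsymbol{\omega},t)\ \text{ subject to } (\mathbf{p},\mathbf{u},\boldsymbol{\omega},t)\in\mathcal{F}.$$ (a) If $(\mathbf{p}^\diamond,\mathbf{u}^\diamond,\boldsymbol{\omega}^\diamond,t^\diamond)\in\mathcal{H}$ is a solution of $(\ast)$, then $\mathbf{p}^\diamond\in\operatorname{argmin}\Psi(\mathfrak{S}_\star)$.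 (b) For $\alpha\in(0,1)$ define $\widetilde T_{\mathrm{DRS}_\alpha}:\mathcal{H}\to\mathcal{H}$ by $(\mathbf{p},\mathbf{u},\boldsymbol{\omega},t)\mapsto\big((1-\alpha)(\mathbf{p},\mathbf{u})+\alpha T_{\mathrm{DRS}}(\mathbf{p},\mathbf{u}),\boldsymbol{\omega},t\big)$ and $$T:=P_{\mathfrak{B}}\circ\widetilde T_{\mathrm{DRS}_\alpha}\circ P_{E_{K-1,K}}\circ\cdots\circ P_{E_{1,2}}\circ P_{L_{K-1,K}}\circ\cdots\circ P_{L_{1,2}},$$ where each of the two chains of projections runs over all pairs $(r,s)$ with $1\le r<s\le K$. Then $T$ is an averaged nonexpansive operator on $\mathcal{H}$ and $\mathrm{Fix}(T)=\mathcal{F}$. (c) Let $\Theta:\mathcal{H}\to\mathbb{R}$, $\Theta(\mathbf{p},\mathbf{u},\boldsymbol{\omega},t)=t$, and, for a fixed $\alpha\in(0,1)$, let $T=P_{\mathfrak{B}}\circ\widetilde T_{\mathrm{DRS}_\alpha}\circ P_{E_{K-1,K}}\circ\cdots\circ P_{E_{1,2}}\circ P_{L_{K-1,K}}\circ\cdots\circ P_{L_{1,2}}$, where $\widetilde T_{\mathrm{DRS}_\alpha}(\mathbf{p},\mathbf{u},\boldsymbol{\omega},t)=\big((1-\alpha)(\mathbf{p},\mathbf{u})+\alpha T_{\mathrm{DRS}}(\mathbf{p},\mathbf{u}),\boldsymbol{\omega},t\big)$ and each of the two chains of projections runs over all pairs $(r,s)$ with $1\le r<s\le K$. Let $(\lambda_n)_{n\ge1}\subset[0,\infty)$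 satisfy $\lim_{n\to\infty}\lambda_n=0$ and $\sum_{n\ge1}\lambda_n=\infty$. For any $\mathbf{z}_0\in\mathcal{H}$, the sequence $\mathbf{z}_n=(\mathbf{p}_n,\mathbf{u}_n,\boldsymbol{\omega}_n,t_n)$ generated by $\mathbf{z}_{n+1}=T(\mathbf{z}_n)-\lambda_{n+1}\nabla\Theta(T(\mathbf{z}_n))$ $(n\ge0)$ satisfies $$\lim_{n\to\infty}\min_{\mathbf{z}^\diamond\in\mathfrak{S}^\diamond_{\mathcal{H}}}\|\mathbf{z}_n-\mathbf{z}^\diamond\|_{\mathcal{H}}=0\quad\text{and}\quad \lim_{n\to\infty}\ \min_{\mathbf{p}^{\star\star}\in\operatorname{argmin}\Psi(\mathfrak{S}_\star)\cap\bar B_{\mathcal{H}_1}(0,\varrho_1)}\|\mathbf{p}_n-\mathbf{p}^{\star\star}\|_{\mathcal{H}_1}=0,$$ where $\mathfrak{S}^\diamond_{\mathcal{H}}$ is the set of all solutions of $(\ast)$.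
   Context: Setting. $N,M\ge1$, $K\ge2$ are integers, $\mathcal{I}_K:=\{1,\dots,K\}$, and $\mathcal{D}=\{(\mathbf{x}_i,y_i)\in\mathbb{R}^N\times\mathcal{I}_K\mid i=1,\dots,M\}$ is a given training dataset. Parameters of a multiclass linear classifier are $\mathbf{p}=(\mathbf{w}_j,b_j)_{j\in\mathcal{I}_K}\in\mathbb{R}^{(N+1)K}$ with $\mathbf{w}_j\in\mathbb{R}^N$, $b_j\in\mathbb{R}$. $\|\cdot\|$ is the Euclidean norm. Generalized hinge loss: $$\Phi_{\mathcal{D}}(\mathbf{p}):=\sum_{i=1}^M\max\Big\{0,\max_{s\in\mathcal{I}_K\setminus\{y_i\}}\big[1-((\mathbf{w}_{y_i}-\mathbf{w}_s)^\top\mathbf{x}_i+(b_{y_i}-b_s))\big]\Big\}.$$ $\mathfrak{S}_\star:=\operatorname{argmin}\Phi_{\mathcal{D}}(\mathbb{R}^{(N+1)K})$ is the set of minimizers of $\Phi_{\mathcal{D}}$ over $\mathbb{R}^{(N+1)K}$. Second-stage criterion: $\Psi(\mathbf{p}):=\max_{1\le r<s\le K}\|\mathbf{w}_r-\mathbf{w}_s\|$. The hierarchical problem is to minimize $\Psi$ over $\mathfrak{S}_\star$. Operators. For $i=1,\dots,M$: $r^{(j)}_{\mathcal{D},i}:=0$ if $j=y_i$ and $:=1$ otherwise; $h_i:\mathbb{R}^K\to\mathbb{R}$, $h_i(\xi_1,\dots,\xi_K):=\max_{j\in\mathcal{I}_K}\{r^{(j)}_{\mathcal{D},i}+\xi_j\}$;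 $A_{\mathcal{D},i}:\mathbb{R}^{(N+1)K}\to\mathbb{R}^K$, $$A_{\mathcal{D},i}\mathbf{p}:=\big((\mathbf{w}_j-\mathbf{w}_{y_i})^\top\mathbf{x}_i+(b_j-b_{y_i})\big)_{j\in\mathcal{I}_K},$$ so that $\Phi_{\mathcal{D}}(\mathbf{p})=\sum_{i=1}^Mh_i(A_{\mathcal{D},i}\mathbf{p})$. Let $\mathcal{X}:=\mathcal{H}_1\times\mathcal{H}_2=\mathbb{R}^{(N+1)K}\times\mathbb{R}^{KM}$, with elements $(\mathbf{p},\mathbf{u})$, $\mathbf{u}=(\mathbf{u}_1,\dots,\mathbf{u}_M)$, $\mathbf{u}_i\in\mathbb{R}^K$. Let $\check A_{\mathcal{D}}:\mathcal{X}\to\mathbb{R}^{KM}$, $(\mathbf{p},\mathbf{u})\mapsto(A_{\mathcal{D},i}\mathbf{p})_{i=1}^M-\mathbf{u}$, with null space $\mathcal{N}(\check A_{\mathcal{D}})$. Let $f(\mathbf{p},\mathbf{u}):=\sum_{i=1}^Mh_i(\mathbf{u}_i)$ and let $g$ be the indicator function of $\mathcal{N}(\check A_{\mathcal{D}})$ ($0$ on it, $+\infty$ elsewhere). The proximity operator of a proper lower semicontinuous convex $\varphi$ is $\mathrm{prox}_\varphi(x):=\operatorname{argmin}_y[\varphi(y)+\tfrac12\|y-x\|^2]$; thus $\mathrm{prox}_f(\mathbf{p},\mathbf{u})=(\mathbf{p},(\mathrm{prox}_{h_1}(\mathbf{u}_1),\dots,\mathrm{prox}_{h_M}(\mathbf{u}_M)))$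 and $\mathrm{prox}_g=P_{\mathcal{N}(\check A_{\mathcal{D}})}$. The Douglas–Rachford operator is $$T_{\mathrm{DRS}}:=(2\,\mathrm{prox}_f-\mathrm{Id})\circ(2\,\mathrm{prox}_g-\mathrm{Id}):\mathcal{X}\to\mathcal{X}.$$ Notation. $P_C$ is the metric projection onto a nonempty closed convex set $C$; $\mathrm{Fix}(T)=\{x\mid T(x)=x\}$; $\bar B_{\mathcal{H}_i}(0,\varrho)$ is the closed ball of radius $\varrho$ centered at $0$ in $\mathcal{H}_i$. An operator $T$ is nonexpansive if $\|T(x)-T(y)\|\le\|x-y\|$ for all $x,y$; it is averaged nonexpansive if $T=(1-a)\mathrm{Id}+aR$ for some $a\in(0,1)$ and some nonexpansive $R$. The product of pairs in the composition $T$ is taken in a fixed order of the pairs $(r,s)$, $r<s$, starting with $(1,2)$ and ending with $(K-1,K)$.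
   Formalization: Fix(T)=F in (b) and all of (c) are proved under an added condition: if 0 minimizes the hinge loss, then ϱ2 ≥ √M. Without it F can be empty while T has fixed points (N=1, M=K=2, x_1=x_2=0, y=(1,2), Υ=1, ϱ1=0.01). *)

theory Defs
  imports "HOL-Analysis.Analysis"
begin

text \<open>
  The index sets of size \<open>N\<close>, \<open>M\<close> and \<open>K \<ge> 2\<close> are finite types \<open>'n\<close>, \<open>'m\<close> and \<open>'k\<close>; the class
  labels \<open>'k\<close> carry a linear order, and \<open>K \<ge> 2\<close> is the class \<open>card2\<close>.  The type \<open>'k label_pair\<close>
  consists of the \<open>K (K - 1) / 2\<close> pairs \<open>(r, s)\<close> with \<open>r < s\<close>.  The norms that the
  library puts on products and on vectors of vectors are the Euclidean ones.
\<close>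

lemma ex_label_pair: "\<exists>p. p \<in> {(r::'k::{card2,linorder}, s). r < s}"
proof -
  have "\<not> card (UNIV :: 'k set) \<le> Suc 0"
    using two_le_card[where 'a = 'k] by simp
  then obtain a b :: 'k where "a \<noteq> b"
    by (auto simp: card_le_Suc0_iff_eq)
  then show ?thesis
    by (cases a b rule: linorder_cases) auto
qed

typedef (overloaded) 'k label_pair = "{(r::'k::{card2,linorder}, s). r < s}"
  by (rule ex_label_pair)

instance label_pair :: ("{card2,linorder}") finite
proof
  have "inj (Rep_label_pair :: 'a label_pair \<Rightarrow> _)"
    by (simp add: inj_on_def Rep_label_pair_inject)
  then show "finite (UNIV :: 'a label_pair set)"
    by (rule finite_imageD[rotated]) (rule finite_subset[OF subset_UNIV finite])
qed

definition pair_fst :: "'k::{card2,linorder} label_pair \<Rightarrow> 'k" where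
  "pair_fst q = fst (Rep_label_pair q)"

definition pair_snd :: "'k::{card2,linorder} label_pair \<Rightarrow> 'k" where
  "pair_snd q = snd (Rep_label_pair q)"

type_synonym ('n, 'k) H1 = "((real ^ 'n) \<times> real) ^ 'k"
type_synonym ('k, 'm) H2 = "real ^ 'k ^ 'm"
type_synonym ('n, 'k) H3 = "real ^ 'n ^ ('k label_pair)"
type_synonym ('n, 'k, 'm) X = "('n, 'k) H1 \<times> ('k, 'm) H2"
type_synonym ('n, 'k, 'm) H =
  "('n, 'k) H1 \<times> ('k, 'm) H2 \<times> ('n, 'k) H3 \<times> real"

definition weight :: "('n::finite, 'k::finite) H1 \<Rightarrow> 'k \<Rightarrow> real ^ 'n" where
  "weight p j = fst (p $ j)"

definition bias :: "('n::finite, 'k::finite) H1 \<Rightarrow> 'k \<Rightarrow> real" where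
  "bias p j = snd (p $ j)"

definition argmin_set :: "('a \<Rightarrow> 'b::ord) \<Rightarrow> 'a set \<Rightarrow> 'a set" where
  "argmin_set f S = {a. is_arg_min f (\<lambda>z. z \<in> S) a}"

definition is_minimum :: "('a \<Rightarrow> 'b::ord) \<Rightarrow> 'a set \<Rightarrow> 'b \<Rightarrow> bool" where
  "is_minimum f S m \<longleftrightarrow> (\<exists>a \<in> argmin_set f S. f a = m)"

definition Fix :: "('a \<Rightarrow> 'a) \<Rightarrow> 'a set" where
  "Fix T = {z. T z = z}"

definition nonexpansive :: "('a::real_normed_vector \<Rightarrow> 'a) \<Rightarrow> bool" where
  "nonexpansive T \<longleftrightarrow> (\<forall>v w. norm (T v - T w) \<le> norm (v - w))"

definition averaged_nonexpansive :: "('a::real_normed_vector \<Rightarrow> 'a) \<Rightarrow> bool" where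
  "averaged_nonexpansive T \<longleftrightarrow>
     (\<exists>a R. 0 < a \<and> a < 1 \<and> nonexpansive R \<and> (\<forall>v. T v = (1 - a) *\<^sub>R v + a *\<^sub>R R v))"

definition prox :: "('a::real_normed_vector \<Rightarrow> ereal) \<Rightarrow> 'a \<Rightarrow> 'a" where
  "prox \<phi> v = (THE w. w \<in> argmin_set (\<lambda>w. \<phi> w + ereal (1/2 * (norm (w - v))\<^sup>2)) UNIV)"

definition indicator_fun :: "'a set \<Rightarrow> 'a \<Rightarrow> ereal" where
  "indicator_fun S v = (if v \<in> S then 0 else \<infinity>)"

definition grad :: "('a::real_inner \<Rightarrow> real) \<Rightarrow> 'a \<Rightarrow> 'a" where
  "grad \<phi> v = (THE D. GDERIV \<phi> v :> D)"

text \<open>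
  The training data are the pairs \<open>(x i, y i)\<close> for \<open>i :: 'm\<close>.
\<close>

definition hinge_loss ::
  "('m::finite \<Rightarrow> real ^ 'n::finite) \<Rightarrow> ('m \<Rightarrow> 'k::{card2,linorder}) \<Rightarrow> ('n, 'k) H1 \<Rightarrow> real" where
  "hinge_loss x y p =
     (\<Sum>i\<in>UNIV. max 0 (MAX s\<in>UNIV - {y i}.
        1 - ((weight p (y i) - weight p s) \<bullet> x i + (bias p (y i) - bias p s))))"

definition hinge_minimizers ::
  "('m::finite \<Rightarrow> real ^ 'n::finite) \<Rightarrow> ('m \<Rightarrow> 'k::{card2,linorder}) \<Rightarrow> ('n, 'k) H1 set" where
  "hinge_minimizers x y = argmin_set (hinge_loss x y) UNIV"

definition Psi :: "('n::finite, 'k::{card2,linorder}) H1 \<Rightarrow> real" where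
  "Psi p = (MAX q\<in>UNIV. norm (weight p (pair_fst q) - weight p (pair_snd q)))"

definition A_op ::
  "('m::finite \<Rightarrow> real ^ 'n::finite) \<Rightarrow> ('m \<Rightarrow> 'k::{card2,linorder}) \<Rightarrow> 'm \<Rightarrow> ('n, 'k) H1 \<Rightarrow> (real, 'k) vec"
  where
  "A_op x y i p = (\<chi> j. (weight p j - weight p (y i)) \<bullet> x i + (bias p j - bias p (y i)))"

definition h_fun :: "('m::finite \<Rightarrow> 'k::{card2,linorder}) \<Rightarrow> 'm \<Rightarrow> (real, 'k) vec \<Rightarrow> real" where
  "h_fun y i \<xi> = (MAX j\<in>UNIV. (if j = y i then 0 else 1) + \<xi> $ j)"

definition A_check ::
  "('m::finite \<Rightarrow> real ^ 'n::finite) \<Rightarrow> ('m \<Rightarrow> 'k::{card2,linorder}) \<Rightarrow> ('n, 'k, 'm) X \<Rightarrow> ('k, 'm) H2"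
  where
  "A_check x y = (\<lambda>(p, u). (\<chi> i. A_op x y i p) - u)"

definition null_A ::
  "('m::finite \<Rightarrow> real ^ 'n::finite) \<Rightarrow> ('m \<Rightarrow> 'k::{card2,linorder}) \<Rightarrow> ('n, 'k, 'm) X set" where
  "null_A x y = {v. A_check x y v = 0}"

definition f_fun :: "('m::finite \<Rightarrow> 'k::{card2,linorder}) \<Rightarrow> ('n::finite, 'k, 'm) X \<Rightarrow> real" where
  "f_fun y = (\<lambda>(p, u). \<Sum>i\<in>UNIV. h_fun y i (u $ i))"

definition T_DRS ::
  "('m::finite \<Rightarrow> real ^ 'n::finite) \<Rightarrow> ('m \<Rightarrow> 'k::{card2,linorder}) \<Rightarrow>
     ('n, 'k, 'm) X \<Rightarrow> ('n, 'k, 'm) X" where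
  "T_DRS x y =
     (\<lambda>v. 2 *\<^sub>R prox (\<lambda>w. ereal (f_fun y w)) v - v) \<circ>
     (\<lambda>v. 2 *\<^sub>R prox (indicator_fun (null_A x y)) v - v)"

definition B_set ::
  "real \<Rightarrow> real \<Rightarrow> real \<Rightarrow> real \<Rightarrow> ('n::finite, 'k::{card2,linorder}, 'm::finite) H set" where
  "B_set \<rho>1 \<rho>2 \<rho>3 \<rho>4 = cball 0 \<rho>1 \<times> cball 0 \<rho>2 \<times> cball 0 \<rho>3 \<times> {- \<rho>4..\<rho>4}"

definition Omega_op ::
  "'k::{card2,linorder} label_pair \<Rightarrow> ('n::finite, 'k, 'm::finite) X \<Rightarrow> real ^ 'n" where
  "Omega_op q = (\<lambda>(p, u). weight p (pair_fst q) - weight p (pair_snd q))"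

definition E_set ::
  "'k::{card2,linorder} label_pair \<Rightarrow> ('n::finite, 'k, 'm::finite) H set" where
  "E_set q = {(p, u, \<omega>, t). norm (\<omega> $ q) \<le> t}"

definition L_set ::
  "('m::finite \<Rightarrow> real ^ 'n::finite) \<Rightarrow> ('m \<Rightarrow> 'k::{card2,linorder}) \<Rightarrow>
     'k label_pair \<Rightarrow> ('n, 'k, 'm) H set" where
  "L_set x y q = {(p, u, \<omega>, t). \<omega> $ q = Omega_op q (closest_point (null_A x y) (p, u))}"

definition F_set ::
  "('m::finite \<Rightarrow> real ^ 'n::finite) \<Rightarrow> ('m \<Rightarrow> 'k::{card2,linorder}) \<Rightarrow>
     real \<Rightarrow> real \<Rightarrow> real \<Rightarrow> real \<Rightarrow> ('n, 'k, 'm) H set" where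
  "F_set x y \<rho>1 \<rho>2 \<rho>3 \<rho>4 =
     {(p, u, \<omega>, t). (p, u) \<in> Fix (T_DRS x y)} \<inter> B_set \<rho>1 \<rho>2 \<rho>3 \<rho>4 \<inter>
     (\<Inter>q. E_set q \<inter> L_set x y q)"

definition Theta :: "('n::finite, 'k::{card2,linorder}, 'm::finite) H \<Rightarrow> real" where
  "Theta = (\<lambda>(p, u, \<omega>, t). t)"

definition solutions ::
  "('m::finite \<Rightarrow> real ^ 'n::finite) \<Rightarrow> ('m \<Rightarrow> 'k::{card2,linorder}) \<Rightarrow>
     real \<Rightarrow> real \<Rightarrow> real \<Rightarrow> real \<Rightarrow> ('n, 'k, 'm) H set" where
  "solutions x y \<rho>1 \<rho>2 \<rho>3 \<rho>4 = argmin_set Theta (F_set x y \<rho>1 \<rho>2 \<rho>3 \<rho>4)"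

definition T_DRS_relaxed ::
  "('m::finite \<Rightarrow> real ^ 'n::finite) \<Rightarrow> ('m \<Rightarrow> 'k::{card2,linorder}) \<Rightarrow> real \<Rightarrow>
     ('n, 'k, 'm) H \<Rightarrow> ('n, 'k, 'm) H" where
  "T_DRS_relaxed x y \<alpha> = (\<lambda>(p, u, \<omega>, t).
     let (p', u') = (1 - \<alpha>) *\<^sub>R (p, u) + \<alpha> *\<^sub>R T_DRS x y (p, u) in (p', u', \<omega>, t))"

text \<open>
  An enumeration of all pairs \<open>r < s\<close> that starts with \<open>(1, 2)\<close> and ends with \<open>(K - 1, K)\<close>.
\<close>

definition pair_enumeration :: "'k::{card2,linorder} label_pair list \<Rightarrow> bool" where
  "pair_enumeration qs \<longleftrightarrow>
     distinct qs \<and> set qs = UNIV \<and>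
     pair_fst (hd qs) = Min UNIV \<and> pair_snd (hd qs) = Min (UNIV - {Min UNIV}) \<and>
     pair_fst (last qs) = Max (UNIV - {Max UNIV}) \<and> pair_snd (last qs) = Max UNIV"

text \<open>
  \<open>fold\<close> applies the projection belonging to the first list element first, i.e. that factor is
  the rightmost one of the composition.
\<close>

definition T_op ::
  "('m::finite \<Rightarrow> real ^ 'n::finite) \<Rightarrow> ('m \<Rightarrow> 'k::{card2,linorder}) \<Rightarrow>
     real \<Rightarrow> real \<Rightarrow> real \<Rightarrow> real \<Rightarrow> 'k label_pair list \<Rightarrow> real \<Rightarrow>
     ('n, 'k, 'm) H \<Rightarrow> ('n, 'k, 'm) H" where
  "T_op x y \<rho>1 \<rho>2 \<rho>3 \<rho>4 qs \<alpha> =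
     closest_point (B_set \<rho>1 \<rho>2 \<rho>3 \<rho>4) \<circ> T_DRS_relaxed x y \<alpha> \<circ>
     fold (\<lambda>q. closest_point (E_set q)) qs \<circ> fold (\<lambda>q. closest_point (L_set x y q)) qs"

text \<open>
  The bounds \<open>\<parallel>x i\<parallel> \<le> \<Upsilon>\<close> and \<open>argmin \<Psi> \<inter> cball 0 \<rho>1 \<noteq> {}\<close> alone do not make the ball of radius
  \<open>\<rho>2\<close> large enough: a point of \<open>Fix T_DRS\<close> has \<open>u\<close>-component \<open>A p - g\<close>, where every \<open>g i\<close> lies in
  the probability simplex, hence is bounded away from \<open>0\<close> independently of \<open>\<rho>1\<close>.  If \<open>0\<close> minimizes
  the hinge loss, \<open>\<rho>1\<close> may be arbitrarily small, and then the feasible set can be empty although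
  the composite operator, a continuous map into a compact convex set, has fixed points.
  The following condition excludes this; \<open>sqrt M\<close> bounds the norm of \<open>g\<close>.  It demands nothing
  when \<open>0\<close> is not a minimizer of the hinge loss.
\<close>

definition radius_large_enough ::
  "('m::finite \<Rightarrow> real ^ 'n::finite) \<Rightarrow> ('m \<Rightarrow> 'k::{card2,linorder}) \<Rightarrow> real \<Rightarrow> bool" where
  "radius_large_enough x y \<rho>2 \<longleftrightarrow>
     (0 \<in> hinge_minimizers x y \<longrightarrow> sqrt (real CARD('m)) \<le> \<rho>2)"

end

theory Submission
  imports Defs
begin

text \<open>
  Write \<open>A p\<close> for all margins of the samples under \<open>p\<close>, so that the hinge loss is \<open>\<phi> \<circ> A\<close> with
  \<open>\<phi>\<close> convex and Lipschitz.  The fixed points of the Douglas--Rachford operator are exactly the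
  points \<open>(p, A p - v)\<close> with \<open>v\<close> a subgradient of \<open>\<phi>\<close> at \<open>A p\<close> that is orthogonal to the range
  of \<open>A\<close>; such a \<open>v\<close> exists iff \<open>p\<close> is a minimizer, and then it serves every other minimizer as
  well.  Orthogonality gives \<open>\<parallel>A p - v\<parallel>\<^sup>2 = \<parallel>A p\<parallel>\<^sup>2 + \<parallel>v\<parallel>\<^sup>2\<close>, and \<open>\<parallel>v\<parallel>\<^sup>2 \<le> M\<close> because \<open>\<phi>\<close> is
  Lipschitz with constant \<open>sqrt M\<close>.  Hence a minimizer of \<open>\<Psi>\<close> of norm at most \<open>\<rho>1\<close> yields a
  feasible point, unless \<open>0\<close> minimizes the hinge loss; in that case \<open>(0, - v, 0, 0)\<close> is used.
  Consequently the averaged factors of \<open>T\<close> have a common fixed point, so the fixed points of \<open>T\<close>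
  are the common ones, and the iteration is a hybrid steepest descent over a bounded fixed point set.
\<close>

section \<open>Averaged operators\<close>

text \<open>
  An operator is averaged iff this holds for some \<open>\<kappa> > 0\<close>, and it is firmly nonexpansive iff it
  holds for \<open>\<kappa> = 1\<close>.
\<close>

definition averaged_with :: "real \<Rightarrow> ('a::real_inner \<Rightarrow> 'a) \<Rightarrow> bool" where
  "averaged_with \<kappa> T \<longleftrightarrow>
     (\<forall>v w. (norm (T v - T w))\<^sup>2 + \<kappa> * (norm ((v - T v) - (w - T w)))\<^sup>2 \<le> (norm (v - w))\<^sup>2)"

text \<open>Applied to \<open>d = v - w\<close> and \<open>r = R v - R w\<close>, this identity
  turns nonexpansiveness of \<open>R\<close> into the inequality of \<open>averaged_with\<close> for
  \<open>\<kappa> = (1 - a) / a\<close>, and back.\<close>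

lemma norm_convex_combination:
  fixes d r :: "'a::real_inner"
  shows "(norm ((1 - a) *\<^sub>R d + a *\<^sub>R r))\<^sup>2 + a * (1 - a) * (norm (d - r))\<^sup>2
    = (1 - a) * (norm d)\<^sup>2 + a * (norm r)\<^sup>2"
  unfolding power2_norm_eq_inner
  by (simp add: inner_simps inner_commute[of r d]) (simp add: algebra_simps)

lemma averaged_nonexpansiveE:
  fixes T :: "'a::real_inner \<Rightarrow> 'a"
  assumes "averaged_nonexpansive T"
  obtains \<kappa> where "0 < \<kappa>" "averaged_with \<kappa> T"
proof -
  obtain a R where a: "0 < a" "a < 1" and R: "nonexpansive R"
    and T: "\<And>v. T v = (1 - a) *\<^sub>R v + a *\<^sub>R R v"
    using assms unfolding averaged_nonexpansive_def by auto
  have "averaged_with ((1 - a) / a) T"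
    unfolding averaged_with_def
  proof (intro allI)
    fix v w
    let ?d = "v - w" and ?r = "R v - R w"
    have 1: "T v - T w = (1 - a) *\<^sub>R ?d + a *\<^sub>R ?r"
      by (simp add: T algebra_simps)
    have "(v - T v) - (w - T w) = a *\<^sub>R (?d - ?r)"
      by (simp add: T algebra_simps)
    then have 2: "(1 - a) / a * (norm ((v - T v) - (w - T w)))\<^sup>2 = a * (1 - a) * (norm (?d - ?r))\<^sup>2"
      using a by (simp add: power_mult_distrib power2_eq_square)
    have "norm ?r \<le> norm ?d"
      using R by (simp add: nonexpansive_def)
    then have "a * (norm ?r)\<^sup>2 \<le> a * (norm ?d)\<^sup>2"
      using a by (intro mult_left_mono power_mono) auto
    then show "(norm (T v - T w))\<^sup>2 + (1 - a) / a * (norm ((v - T v) - (w - T w)))\<^sup>2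
        \<le> (norm ?d)\<^sup>2"
      unfolding 2 unfolding 1 norm_convex_combination by (simp add: algebra_simps)
  qed
  then show thesis
    using a by (intro that[of "(1 - a) / a"]) auto
qed

lemma averaged_nonexpansiveI:
  fixes T :: "'a::real_inner \<Rightarrow> 'a"
  assumes "0 < \<kappa>" and av: "averaged_with \<kappa> T"
  shows "averaged_nonexpansive T"
proof -
  \<comment> \<open>This \<open>a\<close> solves \<open>\<kappa> = (1 - a) / a\<close>; then
    \<open>R\<close> is forced by \<open>T = (1 - a) Id + a R\<close>.\<close>
  define a where "a = 1 / (1 + \<kappa>)"
  define R where "R v = v - (1 / a) *\<^sub>R (v - T v)" for v
  have a: "0 < a" "a < 1"
    using assms by (auto simp: a_def)
  have \<kappa>: "\<kappa> = (1 - a) / a"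
    using assms by (simp add: a_def field_simps)
  have T: "T v = (1 - a) *\<^sub>R v + a *\<^sub>R R v" for v
    using a by (simp add: R_def algebra_simps)
  have "norm (R v - R w) \<le> norm (v - w)" for v w
  proof -
    let ?d = "v - w" and ?r = "R v - R w"
    have 1: "T v - T w = (1 - a) *\<^sub>R ?d + a *\<^sub>R ?r"
      by (simp add: T algebra_simps)
    have "(v - T v) - (w - T w) = a *\<^sub>R (?d - ?r)"
      by (simp add: T algebra_simps)
    then have 2: "\<kappa> * (norm ((v - T v) - (w - T w)))\<^sup>2 = a * (1 - a) * (norm (?d - ?r))\<^sup>2"
      using a by (simp add: \<kappa> power_mult_distrib power2_eq_square)
    have "(norm (T v - T w))\<^sup>2 + \<kappa> * (norm ((v - T v) - (w - T w)))\<^sup>2 \<le> (norm ?d)\<^sup>2"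
      using av unfolding averaged_with_def by blast
    then have "a * (norm ?r)\<^sup>2 \<le> a * (norm ?d)\<^sup>2"
      unfolding 2 unfolding 1 norm_convex_combination by (simp add: algebra_simps)
    then show ?thesis
      using a by simp
  qed
  then show ?thesis
    unfolding averaged_nonexpansive_def nonexpansive_def using a T by blast
qed

lemma averaged_nonexpansive_imp_nonexpansive:
  fixes T :: "'a::real_inner \<Rightarrow> 'a"
  assumes "averaged_nonexpansive T"
  shows "nonexpansive T"
proof -
  obtain \<kappa> where \<kappa>: "0 < \<kappa>" "averaged_with \<kappa> T"
    using averaged_nonexpansiveE assms .
  have "(norm (T v - T w))\<^sup>2 \<le> (norm (v - w))\<^sup>2" for v w
  proof -
    have "0 \<le> \<kappa> * (norm ((v - T v) - (w - T w)))\<^sup>2"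
      using \<kappa> by simp
    then show ?thesis
      using \<kappa>(2) unfolding averaged_with_def by (smt (verit))
  qed
  then show ?thesis
    unfolding nonexpansive_def by (simp add: power2_le_iff_abs_le)
qed

text \<open>The displacements of \<open>T\<close> at \<open>v\<close> and of \<open>S\<close> at
  \<open>T v\<close> add up to that of the composition. Bounding the square of a sum by twice the
  sum of the squares halves the smaller of the two constants.\<close>

lemma averaged_nonexpansive_comp:
  fixes S T :: "'a::real_inner \<Rightarrow> 'a"
  assumes "averaged_nonexpansive S" "averaged_nonexpansive T"
  shows "averaged_nonexpansive (S \<circ> T)"
proof -
  obtain \<kappa> where \<kappa>: "0 < \<kappa>" "averaged_with \<kappa> S"
    using averaged_nonexpansiveE assms(1) .
  obtain \<mu> where \<mu>: "0 < \<mu>" "averaged_with \<mu> T"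
    using averaged_nonexpansiveE assms(2) .
  define \<nu> where "\<nu> = min \<kappa> \<mu>"
  have "averaged_with (\<nu> / 2) (S \<circ> T)"
    unfolding averaged_with_def
  proof (intro allI)
    fix v w
    let ?a = "(v - T v) - (w - T w)" and ?b = "(T v - S (T v)) - (T w - S (T w))"
    have "(norm (S (T v) - S (T w)))\<^sup>2 + \<kappa> * (norm ?b)\<^sup>2 \<le> (norm (T v - T w))\<^sup>2"
      using \<kappa> unfolding averaged_with_def by blast
    moreover have "(norm (T v - T w))\<^sup>2 + \<mu> * (norm ?a)\<^sup>2 \<le> (norm (v - w))\<^sup>2"
      using \<mu> unfolding averaged_with_def by blast
    moreover have "\<nu> * (norm ?b)\<^sup>2 \<le> \<kappa> * (norm ?b)\<^sup>2" "\<nu> * (norm ?a)\<^sup>2 \<le> \<mu> * (norm ?a)\<^sup>2"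
      by (auto simp: \<nu>_def intro!: mult_right_mono)
    moreover have "\<nu> / 2 * (norm (?a + ?b))\<^sup>2 \<le> \<nu> * (norm ?a)\<^sup>2 + \<nu> * (norm ?b)\<^sup>2"
    proof -
      have "(norm (?a + ?b))\<^sup>2 + (norm (?a - ?b))\<^sup>2 = 2 * (norm ?a)\<^sup>2 + 2 * (norm ?b)\<^sup>2"
        unfolding power2_norm_eq_inner by (simp only: inner_simps) simp
      then have "(norm (?a + ?b))\<^sup>2 \<le> 2 * ((norm ?a)\<^sup>2 + (norm ?b)\<^sup>2)"
        by (smt (verit) zero_le_power2)
      then have "\<nu> / 2 * (norm (?a + ?b))\<^sup>2 \<le> \<nu> / 2 * (2 * ((norm ?a)\<^sup>2 + (norm ?b)\<^sup>2))"
        using \<kappa> \<mu> by (intro mult_left_mono) (auto simp: \<nu>_def)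
      then show ?thesis
        by (simp add: algebra_simps)
    qed
    moreover have "?a + ?b = (v - (S \<circ> T) v) - (w - (S \<circ> T) w)"
      by simp
    ultimately show "(norm ((S \<circ> T) v - (S \<circ> T) w))\<^sup>2
        + \<nu> / 2 * (norm ((v - (S \<circ> T) v) - (w - (S \<circ> T) w)))\<^sup>2 \<le> (norm (v - w))\<^sup>2"
      by simp
  qed
  moreover have "0 < \<nu> / 2"
    using \<kappa> \<mu> by (simp add: \<nu>_def)
  ultimately show ?thesis
    using averaged_nonexpansiveI by blast
qed

text \<open>Let \<open>s\<close> be a common fixed point and \<open>S (T z) = z\<close>. Unless
  \<open>T z = z\<close>, the point \<open>T z\<close> is strictly closer to \<open>s\<close> than
  \<open>z\<close> is; since \<open>S\<close> does not increase the distance to \<open>s\<close>,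
  this would make \<open>z\<close> closer to \<open>s\<close> than itself.\<close>

lemma Fix_comp:
  fixes S T :: "'a::real_inner \<Rightarrow> 'a"
  assumes "averaged_nonexpansive S" "averaged_nonexpansive T" "Fix S \<inter> Fix T \<noteq> {}"
  shows "Fix (S \<circ> T) = Fix S \<inter> Fix T"
proof (intro subset_antisym subsetI)
  fix z assume "z \<in> Fix (S \<circ> T)"
  then have z: "S (T z) = z"
    by (simp add: Fix_def)
  obtain s where s: "S s = s" "T s = s"
    using assms(3) by (auto simp: Fix_def)
  obtain \<mu> where \<mu>: "0 < \<mu>" "averaged_with \<mu> T"
    using averaged_nonexpansiveE assms(2) .
  have "norm (S (T z) - S s) \<le> norm (T z - s)"
    using averaged_nonexpansive_imp_nonexpansive[OF assms(1)] unfolding nonexpansive_def by blast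
  then have 1: "(norm (z - s))\<^sup>2 \<le> (norm (T z - s))\<^sup>2"
    by (simp add: z s)
  have "(norm (T z - T s))\<^sup>2 + \<mu> * (norm ((z - T z) - (s - T s)))\<^sup>2 \<le> (norm (z - s))\<^sup>2"
    using \<mu> unfolding averaged_with_def by blast
  then have "(norm (T z - s))\<^sup>2 + \<mu> * (norm (z - T z))\<^sup>2 \<le> (norm (z - s))\<^sup>2"
    by (simp add: s)
  with 1 have "\<mu> * (norm (z - T z))\<^sup>2 \<le> 0"
    by linarith
  then have "T z = z"
    using \<mu> by (simp add: mult_le_0_iff)
  then show "z \<in> Fix S \<inter> Fix T"
    using z by (simp add: Fix_def)
qed (auto simp: Fix_def)

lemma averaged_nonexpansive_id: "averaged_nonexpansive (id :: 'a::real_inner \<Rightarrow> 'a)"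
  by (rule averaged_nonexpansiveI[of 1]) (auto simp: averaged_with_def)

lemma averaged_nonexpansive_fold:
  fixes T :: "'b \<Rightarrow> 'a::real_inner \<Rightarrow> 'a"
  assumes "\<And>q. averaged_nonexpansive (T q)"
  shows "averaged_nonexpansive (fold T qs)"
proof (induction qs)
  case Nil
  show ?case
    using averaged_nonexpansive_id by (simp add: id_def)
next
  case (Cons q qs)
  then show ?case
    using averaged_nonexpansive_comp[OF Cons.IH assms[of q]] by (simp add: comp_def)
qed

lemma Fix_fold:
  fixes T :: "'b \<Rightarrow> 'a::real_inner \<Rightarrow> 'a"
  assumes av: "\<And>q. averaged_nonexpansive (T q)" and "(\<Inter>q\<in>set qs. Fix (T q)) \<noteq> {}"
  shows "Fix (fold T qs) = (\<Inter>q\<in>set qs. Fix (T q))"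
  using assms(2)
proof (induction qs)
  case Nil
  then show ?case by (simp add: Fix_def)
next
  case (Cons q qs)
  then have IH: "Fix (fold T qs) = (\<Inter>q\<in>set qs. Fix (T q))"
    by auto
  have "Fix (fold T qs \<circ> T q) = Fix (fold T qs) \<inter> Fix (T q)"
    using Cons.prems by (intro Fix_comp averaged_nonexpansive_fold av) (auto simp: IH)
  then have "Fix (fold T (q # qs)) = (\<Inter>q\<in>set qs. Fix (T q)) \<inter> Fix (T q)"
    by (simp only: fold_Cons IH)
  then show ?case
    by (simp only: list.set INT_insert Int_commute)
qed

text \<open>Parallelogram law for \<open>a = P v - P w\<close> and \<open>d - a\<close>, where
  \<open>d = v - w\<close>: their difference is, up to sign, the difference of the reflected
  points.\<close>

lemma nonexpansive_reflection:
  fixes P :: "'a::real_inner \<Rightarrow> 'a"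
  assumes "averaged_with 1 P"
  shows "nonexpansive (\<lambda>v. 2 *\<^sub>R P v - v)"
proof -
  have *: "norm (2 *\<^sub>R a - d) \<le> norm d" if "(norm a)\<^sup>2 + (norm (d - a))\<^sup>2 \<le> (norm d)\<^sup>2" for a d :: 'a
  proof -
    have "(norm (2 *\<^sub>R a - d))\<^sup>2 + (norm d)\<^sup>2 = 2 * ((norm a)\<^sup>2 + (norm (d - a))\<^sup>2)"
      unfolding power2_norm_eq_inner by (simp add: inner_simps inner_commute[of d a])
    then have "(norm (2 *\<^sub>R a - d))\<^sup>2 \<le> (norm d)\<^sup>2"
      using that by (smt (verit))
    then show ?thesis
      by (rule power2_le_imp_le) simp
  qed
  have "norm (2 *\<^sub>R (P v - P w) - (v - w)) \<le> norm (v - w)" for v w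
    using assms unfolding averaged_with_def by (intro *) (simp add: algebra_simps)
  then show ?thesis
    unfolding nonexpansive_def by (simp add: algebra_simps)
qed

text \<open>The two sides of the firm inequality differ by exactly twice this sum. For projections
  and proximity operators its sign follows by adding two variational inequalities.\<close>

lemma averaged_with_1I:
  fixes P :: "'a::real_inner \<Rightarrow> 'a"
  assumes "\<And>v w. (v - P v) \<bullet> (P w - P v) + (w - P w) \<bullet> (P v - P w) \<le> 0"
  shows "averaged_with 1 P"
  unfolding averaged_with_def
proof (intro allI)
  fix v w
  have "(norm (a - b))\<^sup>2 + (norm ((v - a) - (w - b)))\<^sup>2
    = (norm (v - w))\<^sup>2 + 2 * ((v - a) \<bullet> (b - a) + (w - b) \<bullet> (a - b))" for a b :: 'a
    unfolding power2_norm_eq_inner by (simp add: inner_simps inner_commute)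
  then show "(norm (P v - P w))\<^sup>2 + 1 * (norm ((v - P v) - (w - P w)))\<^sup>2 \<le> (norm (v - w))\<^sup>2"
    using assms[of v w] by simp
qed

lemma averaged_with_closest_point:
  fixes S :: "'a::euclidean_space set"
  assumes "closed S" "convex S" "S \<noteq> {}"
  shows "averaged_with 1 (closest_point S)"
proof (rule averaged_with_1I)
  fix v w
  show "(v - closest_point S v) \<bullet> (closest_point S w - closest_point S v)
      + (w - closest_point S w) \<bullet> (closest_point S v - closest_point S w) \<le> 0"
    using assms closest_point_dot[of S "closest_point S w" v]
      closest_point_dot[of S "closest_point S v" w]
    by (simp add: closest_point_in_set)
qed

lemma averaged_nonexpansive_closest_point:
  fixes S :: "'a::euclidean_space set"
  assumes "closed S" "convex S" "S \<noteq> {}"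
  shows "averaged_nonexpansive (closest_point S)"
  using averaged_nonexpansiveI[of 1] averaged_with_closest_point[OF assms] by simp

lemma Fix_closest_point:
  fixes S :: "'a::euclidean_space set"
  assumes "closed S" "S \<noteq> {}"
  shows "Fix (closest_point S) = S"
  using closest_point_in_set[OF assms] closest_point_self[of _ S] unfolding Fix_def
  by (metis (mono_tags, lifting) Collect_cong Collect_mem_eq)

section \<open>Proximity operators and orthogonal projections\<close>

definition subgradient :: "('a::real_inner \<Rightarrow> real) \<Rightarrow> 'a \<Rightarrow> 'a \<Rightarrow> bool" where
  "subgradient \<phi> q g \<longleftrightarrow> (\<forall>w. \<phi> q + g \<bullet> (w - q) \<le> \<phi> w)"

lemma argmin_set_iff:
  fixes f :: "'a \<Rightarrow> 'b::linorder"
  shows "v \<in> argmin_set f S \<longleftrightarrow> v \<in> S \<and> (\<forall>w\<in>S. f v \<le> f w)"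
  by (auto simp: argmin_set_def is_arg_min_def not_less)

text \<open>Monotonicity of the subdifferential: adding both inequalities cancels the values of
  \<open>\<phi>\<close> and leaves the squared distance of \<open>q\<close> and
  \<open>q'\<close>.\<close>

lemma subgradient_prox_unique:
  fixes q q' v :: "'a::real_inner"
  assumes "subgradient \<phi> q (v - q)" "subgradient \<phi> q' (v - q')"
  shows "q = q'"
proof -
  have "\<phi> q + (v - q) \<bullet> (q' - q) \<le> \<phi> q'" "\<phi> q' + (v - q') \<bullet> (q - q') \<le> \<phi> q"
    using assms unfolding subgradient_def by blast+
  moreover have "(v - q) \<bullet> (q' - q) + (v - q') \<bullet> (q - q') = (q - q') \<bullet> (q - q')"
    by (simp add: inner_simps inner_commute)
  ultimately have "(q - q') \<bullet> (q - q') \<le> 0"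
    by linarith
  then have "(q - q') \<bullet> (q - q') = 0"
    using inner_ge_zero[of "q - q'"] by linarith
  then show ?thesis
    by simp
qed

text \<open>The minimizer is compared with the points of the segment from \<open>q\<close> to
  \<open>w\<close>. After division by \<open>t\<close>, the quadratic term still carries a factor
  \<open>t\<close> and disappears as \<open>t\<close> tends to 0.\<close>

lemma subgradient_proxI:
  fixes \<phi> :: "'a::real_inner \<Rightarrow> real"
  assumes cvx: "convex_on UNIV \<phi>"
    and min: "\<And>w. \<phi> q + 1/2 * (norm (q - v))\<^sup>2 \<le> \<phi> w + 1/2 * (norm (w - v))\<^sup>2"
  shows "subgradient \<phi> q (v - q)"
  unfolding subgradient_def
proof
  fix w
  define c where "c = \<phi> w - \<phi> q - (v - q) \<bullet> (w - q)"
  have "0 \<le> c + 1/2 * t * (norm (w - q))\<^sup>2" if t: "0 < t" "t < 1" for t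
  proof -
    have "\<phi> ((1 - t) *\<^sub>R q + t *\<^sub>R w) \<le> (1 - t) * \<phi> q + t * \<phi> w"
      using cvx t by (intro convex_onD) auto
    moreover have "\<phi> q + 1/2 * (norm (q - v))\<^sup>2 \<le> \<phi> ((1 - t) *\<^sub>R q + t *\<^sub>R w)
        + 1/2 * (norm ((1 - t) *\<^sub>R q + t *\<^sub>R w - v))\<^sup>2"
      by (rule min)
    moreover have "(norm ((1 - t) *\<^sub>R q + t *\<^sub>R w - v))\<^sup>2
      = (norm (q - v))\<^sup>2 - 2 * t * ((v - q) \<bullet> (w - q)) + t\<^sup>2 * (norm (w - q))\<^sup>2"
      unfolding power2_norm_eq_inner
      by (simp add: inner_simps inner_commute power2_eq_square) (simp add: algebra_simps)
    ultimately have "0 \<le> t * (c + 1/2 * t * (norm (w - q))\<^sup>2)"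
      by (simp add: c_def algebra_simps power2_eq_square)
    then show ?thesis
      using t by (simp add: zero_le_mult_iff)
  qed
  then have "\<forall>\<^sub>F t in at_right 0. 0 \<le> c + 1/2 * t * (norm (w - q))\<^sup>2"
    by (intro eventually_at_rightI[of 0 1]) auto
  moreover have "((\<lambda>t. c + 1/2 * t * (norm (w - q))\<^sup>2) \<longlongrightarrow> c + 1/2 * 0 * (norm (w - q))\<^sup>2) (at_right 0)"
    by (intro tendsto_intros)
  ultimately have "0 \<le> c"
    using tendsto_lowerbound trivial_limit_at_right_real by fastforce
  then show "\<phi> q + (v - q) \<bullet> (w - q) \<le> \<phi> w"
    by (simp add: c_def)
qed

text \<open>Outside the ball of radius \<open>2 * D\<close> around \<open>v\<close> the quadratic
  term outweighs any decrease of \<open>\<phi>\<close> that the Lipschitz bound permits, so a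
  minimum over this compact ball is global.\<close>

lemma prox_exists:
  fixes \<phi> :: "'a::euclidean_space \<Rightarrow> real"
  assumes lip: "\<And>v w. \<bar>\<phi> v - \<phi> w\<bar> \<le> C * norm (v - w)"
  shows "\<exists>q. \<forall>w. \<phi> q + 1/2 * (norm (q - v))\<^sup>2 \<le> \<phi> w + 1/2 * (norm (w - v))\<^sup>2"
proof -
  let ?g = "\<lambda>w. \<phi> w + 1/2 * (norm (w - v))\<^sup>2"
  define D where "D = max C 0"
  have lipD: "\<bar>\<phi> v - \<phi> w\<bar> \<le> D * norm (v - w)" for v w
    using lip[of v w] mult_right_mono[of C D "norm (v - w)"] by (simp add: D_def)
  have "D-lipschitz_on UNIV \<phi>"
    using lipD by (intro lipschitz_onI) (auto simp: dist_norm D_def)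
  then have "continuous_on UNIV \<phi>"
    by (rule lipschitz_on_continuous_on)
  then have "continuous_on (cball v (2 * D)) ?g"
    by (intro continuous_intros) (auto intro: continuous_on_subset)
  then obtain q where "q \<in> cball v (2 * D)" and q: "\<And>w. w \<in> cball v (2 * D) \<Longrightarrow> ?g q \<le> ?g w"
    using continuous_attains_inf[of "cball v (2 * D)" ?g] by (auto simp: D_def)
  have "?g q \<le> ?g w" for w
  proof (cases "w \<in> cball v (2 * D)")
    case False
    let ?r = "norm (w - v)"
    have r: "2 * D < ?r"
      using False by (simp add: dist_norm norm_minus_commute)
    have "2 * D * ?r \<le> ?r * ?r"
      using r by (intro mult_right_mono) auto
    moreover have "\<phi> v \<le> \<phi> w + D * ?r"
      using lipD[of w v] by linarith
    ultimately have "\<phi> v \<le> ?g w"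
      by (simp add: power2_eq_square)
    moreover have "?g q \<le> ?g v"
      by (rule q) (simp add: D_def)
    ultimately show ?thesis
      by simp
  qed (rule q)
  then show ?thesis
    by blast
qed

text \<open>\<open>prox\<close> is a definite description, so its value is accessible only after
  existence (from the Lipschitz bound) and uniqueness (from convexity).\<close>

lemma subgradient_prox:
  fixes \<phi> :: "'a::euclidean_space \<Rightarrow> real"
  assumes cvx: "convex_on UNIV \<phi>" and lip: "\<And>v w. \<bar>\<phi> v - \<phi> w\<bar> \<le> C * norm (v - w)"
  shows "subgradient \<phi> (prox (\<lambda>w. ereal (\<phi> w)) v) (v - prox (\<lambda>w. ereal (\<phi> w)) v)"
proof -
  let ?P = "\<lambda>q. q \<in> argmin_set (\<lambda>w. ereal (\<phi> w) + ereal (1/2 * (norm (w - v))\<^sup>2)) UNIV"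
  have P: "?P q \<longleftrightarrow> (\<forall>w. \<phi> q + 1/2 * (norm (q - v))\<^sup>2 \<le> \<phi> w + 1/2 * (norm (w - v))\<^sup>2)" for q
    by (simp add: argmin_set_iff)
  have sub: "subgradient \<phi> q (v - q)" if "?P q" for q
    using that subgradient_proxI[OF cvx] unfolding P by blast
  obtain q where "?P q"
    using prox_exists[of \<phi> C v] lip unfolding P by blast
  then have "\<exists>!q. ?P q"
    using sub subgradient_prox_unique by blast
  then show ?thesis
    unfolding prox_def using theI'[of ?P] sub by blast
qed

lemma prox_eq_iff_subgradient:
  fixes \<phi> :: "'a::euclidean_space \<Rightarrow> real"
  assumes cvx: "convex_on UNIV \<phi>" and lip: "\<And>v w. \<bar>\<phi> v - \<phi> w\<bar> \<le> C * norm (v - w)"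
  shows "prox (\<lambda>w. ereal (\<phi> w)) v = q \<longleftrightarrow> subgradient \<phi> q (v - q)"
  using subgradient_prox[OF cvx lip] subgradient_prox_unique by blast

lemma averaged_with_prox:
  fixes \<phi> :: "'a::euclidean_space \<Rightarrow> real"
  assumes cvx: "convex_on UNIV \<phi>" and lip: "\<And>v w. \<bar>\<phi> v - \<phi> w\<bar> \<le> C * norm (v - w)"
  shows "averaged_with 1 (prox (\<lambda>w. ereal (\<phi> w)))"
proof (rule averaged_with_1I)
  let ?P = "prox (\<lambda>w. ereal (\<phi> w))"
  fix v w
  have "\<phi> (?P v) + (v - ?P v) \<bullet> (?P w - ?P v) \<le> \<phi> (?P w)"
    "\<phi> (?P w) + (w - ?P w) \<bullet> (?P v - ?P w) \<le> \<phi> (?P v)"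
    using subgradient_prox[OF cvx lip] unfolding subgradient_def by blast+
  then show "(v - ?P v) \<bullet> (?P w - ?P v) + (w - ?P w) \<bullet> (?P v - ?P w) \<le> 0"
    by linarith
qed

lemma prox_indicator_fun:
  fixes S :: "'a::euclidean_space set"
  assumes "closed S" "convex S" "S \<noteq> {}"
  shows "prox (indicator_fun S) = closest_point S"
proof
  fix v
  let ?f = "\<lambda>w. indicator_fun S w + ereal (1/2 * (norm (w - v))\<^sup>2)"
  have iff: "q \<in> argmin_set ?f UNIV \<longleftrightarrow> q \<in> S \<and> (\<forall>w\<in>S. dist v q \<le> dist v w)" for q
  proof -
    have 1: "?f w = (if w \<in> S then ereal (1/2 * (dist v w)\<^sup>2) else \<infinity>)" for w
      by (simp add: indicator_fun_def dist_norm norm_minus_commute)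
    have "(\<forall>w. ?f q \<le> ?f w) \<longleftrightarrow> q \<in> S \<and> (\<forall>w\<in>S. dist v q \<le> dist v w)"
      unfolding 1 using assms(3) by (auto split: if_splits)
    then show ?thesis
      by (simp add: argmin_set_iff)
  qed
  show "prox (indicator_fun S) v = closest_point S v"
    unfolding prox_def
  proof (rule the_equality)
    show "closest_point S v \<in> argmin_set ?f UNIV"
      unfolding iff using closest_point_exists[OF assms(1,3), of v] by blast
    show "q = closest_point S v" if "q \<in> argmin_set ?f UNIV" for q
      using that assms unfolding iff by (intro closest_point_unique) auto
  qed
qed

text \<open>In a subspace both \<open>w + s\<close> and \<open>w - s\<close> may be inserted into
  the variational inequality, which makes it an equality; the converse is Pythagoras.\<close>

lemma closest_point_subspace_iff:
  fixes S :: "'a::euclidean_space set"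
  assumes "subspace S"
  shows "closest_point S v = w \<longleftrightarrow> w \<in> S \<and> (\<forall>s\<in>S. (v - w) \<bullet> s = 0)"
proof -
  have S: "closed S" "convex S" "S \<noteq> {}"
    using assms closed_subspace subspace_imp_convex subspace_0 by blast+
  show ?thesis
  proof (intro iffI conjI ballI)
    assume w: "closest_point S v = w"
    then show wS: "w \<in> S"
      using S closest_point_in_set by blast
    fix s assume s: "s \<in> S"
    have "w + s \<in> S" "w - s \<in> S"
      using wS s assms by (auto intro: subspace_add subspace_diff)
    then have "(v - w) \<bullet> (w + s - w) \<le> 0" "(v - w) \<bullet> (w - s - w) \<le> 0"
      using closest_point_dot[OF S(2,1)] w by blast+
    then show "(v - w) \<bullet> s = 0"
      by simp
  next
    assume w: "w \<in> S \<and> (\<forall>s\<in>S. (v - w) \<bullet> s = 0)"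
    have "dist v w \<le> dist v s" if "s \<in> S" for s
    proof -
      have "(v - w) \<bullet> (w - s) = 0"
        using w that assms subspace_diff by blast
      then have "(norm (v - s))\<^sup>2 = (norm (v - w))\<^sup>2 + (norm (w - s))\<^sup>2"
        using norm_add_Pythagorean[of "v - w" "w - s"] by (simp add: orthogonal_def)
      then show ?thesis
        by (simp add: dist_norm power2_le_imp_le)
    qed
    then show "closest_point S v = w"
      using w S closest_point_unique[of S w v] by auto
  qed
qed

text \<open>The orthogonality conditions are stable under sums and multiples. Linearity is what
  makes each \<open>L_set\<close> a subspace.\<close>

lemma linear_closest_point_subspace:
  fixes S :: "'a::euclidean_space set"
  assumes "subspace S"
  shows "linear (closest_point S)"
proof
  have c: "closest_point S v \<in> S" "\<forall>s\<in>S. (v - closest_point S v) \<bullet> s = 0" for v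
    using closest_point_subspace_iff[OF assms] by blast+
  show "closest_point S (v + w) = closest_point S v + closest_point S w" for v w
    unfolding closest_point_subspace_iff[OF assms]
    using c[of v] c[of w] assms by (auto simp: subspace_add inner_simps algebra_simps)
  show "closest_point S (r *\<^sub>R v) = r *\<^sub>R closest_point S v" for r v
    unfolding closest_point_subspace_iff[OF assms]
    using c[of v] assms by (auto simp: subspace_scale inner_simps algebra_simps)
qed

section \<open>Hybrid steepest descent for a linear objective\<close>

lemma nonexpansive_continuous_on:
  fixes T :: "'a::real_normed_vector \<Rightarrow> 'a"
  assumes "nonexpansive T"
  shows "continuous_on A T"
proof -
  have "1-lipschitz_on A T"
    using assms by (intro lipschitz_onI) (auto simp: nonexpansive_def dist_norm)
  then show ?thesis
    by (rule lipschitz_on_continuous_on)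
qed

lemma closed_argmin_set:
  fixes f :: "'a::topological_space \<Rightarrow> real"
  assumes "closed S" "continuous_on UNIV f"
  shows "closed (argmin_set f S)"
proof -
  have "argmin_set f S = S \<inter> (\<Inter>w\<in>S. {v. f v \<le> f w})"
    by (auto simp: argmin_set_iff)
  then show ?thesis
    using assms by (simp add: closed_Int closed_INT closed_Collect_le continuous_on_const)
qed

lemma compact_argmin_set:
  fixes f :: "'a::t2_space \<Rightarrow> real"
  assumes "compact S" "continuous_on UNIV f"
  shows "compact (argmin_set f S)"
proof -
  have "argmin_set f S = S \<inter> argmin_set f S"
    by (auto simp: argmin_set_iff)
  moreover have "closed (argmin_set f S)"
    using assms compact_imp_closed closed_argmin_set by blast
  ultimately show ?thesis
    using assms(1) compact_Int_closed by metis
qed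

lemma argmin_set_nonempty:
  fixes f :: "'a::topological_space \<Rightarrow> real"
  assumes "compact S" "continuous_on UNIV f" "S \<noteq> {}"
  shows "argmin_set f S \<noteq> {}"
  using continuous_attains_inf[of S f] assms
  by (force simp: argmin_set_iff intro: continuous_on_subset)

lemma compact_Fix:
  fixes T :: "'a::euclidean_space \<Rightarrow> 'a"
  assumes "nonexpansive T" "bounded (range T)"
  shows "compact (Fix T)"
proof -
  have "closed {z. T z = id z}"
    by (intro closed_Collect_eq nonexpansive_continuous_on[OF assms(1)] continuous_on_id')
  moreover have "Fix T \<subseteq> range T"
    by (auto simp: Fix_def intro: range_eqI[OF sym])
  ultimately show ?thesis
    using bounded_subset[OF assms(2)] by (simp add: Fix_def compact_eq_bounded_closed)
qed

text \<open>The convergence claims speak of attained minima; this allows them to be treated as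
  statements about \<open>infdist\<close>.\<close>

lemma is_minimum_infdist:
  fixes S :: "'a::euclidean_space set"
  assumes "closed S" "S \<noteq> {}"
  shows "is_minimum (\<lambda>s. norm (z - s)) S (infdist z S)"
proof -
  obtain s where s: "s \<in> S" "infdist z S = dist z s"
    using infdist_attains_inf[OF assms] by blast
  then have "s \<in> argmin_set (\<lambda>s. norm (z - s)) S"
    using infdist_le[of _ S z] by (auto simp: argmin_set_iff dist_norm)
  then show ?thesis
    unfolding is_minimum_def using s by (auto simp: dist_norm)
qed

text \<open>
  Far from the solution set, either \<open>z - T z\<close> or the excess of the objective at \<open>T z\<close> is bounded
  below, and for small steps each of them makes the squared distance to the solutions drop by at
  least a multiple of the step size.  Since the step sizes have divergent sum, the iterates must
  come close to the solution set, and afterwards they cannot leave its neighbourhood.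
\<close>

lemma hybrid_steepest_descent:
  fixes T :: "'a::euclidean_space \<Rightarrow> 'a" and e :: 'a and z :: "nat \<Rightarrow> 'a" and lam :: "nat \<Rightarrow> real"
  assumes av: "averaged_nonexpansive T" and bdd: "bounded (range T)" and ne: "Fix T \<noteq> {}"
    and lam: "\<And>n. n \<ge> 1 \<Longrightarrow> 0 \<le> lam n" "lam \<longlonglongrightarrow> 0"
      "filterlim (\<lambda>n. \<Sum>k=1..n. lam k) at_top sequentially"
    and z: "\<And>n. z (Suc n) = T (z n) - lam (Suc n) *\<^sub>R e"
  shows "(\<lambda>n. infdist (z n) (argmin_set (\<lambda>v. v \<bullet> e) (Fix T))) \<longlonglongrightarrow> 0"
proof -
  let ?S = "argmin_set (\<lambda>v. v \<bullet> e) (Fix T)"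
  let ?d = "\<lambda>n. infdist (z n) ?S"
  have nonexp: "nonexpansive T"
    using av by (rule averaged_nonexpansive_imp_nonexpansive)
  have cF: "compact (Fix T)"
    using compact_Fix[OF nonexp bdd] .
  have cont: "continuous_on UNIV (\<lambda>v. v \<bullet> e)"
    by (intro continuous_intros)
  have S: "closed ?S" "?S \<noteq> {}"
    using compact_imp_closed[OF compact_argmin_set[OF cF cont]] argmin_set_nonempty[OF cF cont ne] by auto
  obtain s0 where s0: "s0 \<in> ?S"
    using S by blast
  \<comment> \<open>The optimal value, shared by all solutions.\<close>
  define \<theta> where "\<theta> = s0 \<bullet> e"
  have \<theta>: "s \<bullet> e = \<theta>" if "s \<in> ?S" for s
    using that s0 unfolding \<theta>_def argmin_set_iff by force
  have S_Fix: "T s = s" if "s \<in> ?S" for s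
    using that by (auto simp: argmin_set_iff Fix_def)
  have S_I: "v \<in> ?S" if "T v = v" "v \<bullet> e \<le> \<theta>" for v
    using that s0 unfolding \<theta>_def argmin_set_iff by (fastforce simp: Fix_def)
  obtain \<kappa> where \<kappa>: "0 < \<kappa>" "averaged_with \<kappa> T"
    using averaged_nonexpansiveE av .
  obtain B where B: "\<And>v. norm (T v) \<le> B"
    using bdd unfolding bounded_iff by auto
  have B0: "0 \<le> B"
    using B[of 0] norm_ge_zero order_trans by blast
  obtain \<Lambda> where \<Lambda>: "\<And>n. \<bar>lam n\<bar> \<le> \<Lambda>"
    using lam(2) Bseq_def convergent_imp_Bseq convergent_def by (metis real_norm_def)
  \<comment> \<open>Every iterate but the first is a value of \<open>T\<close> shifted by one step;
    the starting point is arbitrary and enters separately.\<close>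
  define R where "R = max (norm (z 0)) (B + \<Lambda> * norm e)"
  have R: "norm (z n) \<le> R" for n
  proof (cases n)
    case (Suc m)
    have "norm (z n) \<le> norm (T (z m)) + norm (lam n *\<^sub>R e)"
      unfolding Suc z by (rule norm_triangle_ineq4)
    also have "\<dots> \<le> B + \<Lambda> * norm e"
      using B \<Lambda> by (intro add_mono) (auto intro: mult_right_mono)
    finally show ?thesis
      by (simp add: R_def)
  qed (simp add: R_def)
  have proj: "\<exists>s\<in>?S. ?d n = norm (z n - s)" for n
    using infdist_attains_inf[OF S, of "z n"] by (auto simp: dist_norm)
  \<comment> \<open>A crude bound, used near the solutions: one iteration increases the distance by
    at most the length of the step.\<close>
  have step1: "?d (Suc n) \<le> ?d n + lam (Suc n) * norm e" for n
  proof -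
    obtain s where s: "s \<in> ?S" "?d n = norm (z n - s)"
      using proj by blast
    have "?d (Suc n) \<le> norm (z (Suc n) - s)"
      using infdist_le[OF s(1), of "z (Suc n)"] by (simp add: dist_norm)
    also have "z (Suc n) - s = (T (z n) - T s) - lam (Suc n) *\<^sub>R e"
      using S_Fix[OF s(1)] by (simp add: z)
    also have "norm \<dots> \<le> norm (T (z n) - T s) + norm (lam (Suc n) *\<^sub>R e)"
      by (rule norm_triangle_ineq4)
    also have "\<dots> \<le> norm (z n - s) + lam (Suc n) * norm e"
      using nonexp lam(1)[of "Suc n"] by (simp add: nonexpansive_def)
    finally show ?thesis
      by (simp add: s)
  qed
  \<comment> \<open>The square is expanded at the solution nearest to \<open>z n\<close>;
    averagedness of \<open>T\<close> supplies the displacement term.\<close>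
  have step2: "(?d (Suc n))\<^sup>2 \<le> (?d n)\<^sup>2 - \<kappa> * (norm (z n - T (z n)))\<^sup>2
      - 2 * lam (Suc n) * (T (z n) \<bullet> e - \<theta>) + (lam (Suc n))\<^sup>2 * (norm e)\<^sup>2" for n
  proof -
    obtain s where s: "s \<in> ?S" "?d n = norm (z n - s)"
      using proj by blast
    have "?d (Suc n) \<le> norm (z (Suc n) - s)"
      using infdist_le[OF s(1), of "z (Suc n)"] by (simp add: dist_norm)
    then have "(?d (Suc n))\<^sup>2 \<le> (norm (z (Suc n) - s))\<^sup>2"
      by (intro power_mono) (auto simp: infdist_nonneg)
    also have "\<dots> = (norm ((T (z n) - s) - lam (Suc n) *\<^sub>R e))\<^sup>2"
      by (simp add: z algebra_simps)
    also have "\<dots> = (norm (T (z n) - s))\<^sup>2 - 2 * lam (Suc n) * ((T (z n) - s) \<bullet> e)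
        + (lam (Suc n))\<^sup>2 * (norm e)\<^sup>2"
      unfolding power2_norm_eq_inner
      by (simp add: inner_simps inner_commute power2_eq_square)
    also have "(T (z n) - s) \<bullet> e = T (z n) \<bullet> e - \<theta>"
      by (simp add: inner_diff_left \<theta>[OF s(1)])
    finally have 1: "(?d (Suc n))\<^sup>2 \<le> (norm (T (z n) - s))\<^sup>2 - 2 * lam (Suc n) * (T (z n) \<bullet> e - \<theta>)
        + (lam (Suc n))\<^sup>2 * (norm e)\<^sup>2" .
    have "(norm (T (z n) - T s))\<^sup>2 + \<kappa> * (norm ((z n - T (z n)) - (s - T s)))\<^sup>2 \<le> (norm (z n - s))\<^sup>2"
      using \<kappa>(2) unfolding averaged_with_def by blast
    then have "(norm (T (z n) - s))\<^sup>2 + \<kappa> * (norm (z n - T (z n)))\<^sup>2 \<le> (?d n)\<^sup>2"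
      by (simp add: S_Fix[OF s(1)] s(2))
    with 1 show ?thesis
      by linarith
  qed
  have main: "\<forall>\<^sub>F n in sequentially. ?d n \<le> 2 * \<epsilon>" if \<epsilon>: "0 < \<epsilon>" for \<epsilon>
  proof -
    \<comment> \<open>If \<open>G v \<le> 0\<close>, then \<open>v\<close> is a fixed point with
      objective at most \<open>\<theta>\<close>, hence a solution. So \<open>G\<close> is positive
      off the solution set and has a positive lower bound on the compact set
      \<open>?K\<close>.\<close>
    define G where "G v = max (norm (v - T v)) (T v \<bullet> e - \<theta>)" for v
    obtain \<delta> where \<delta>: "0 < \<delta>"
      and G: "\<And>n. \<epsilon> \<le> ?d n \<Longrightarrow> \<delta> \<le> G (z n)"
    proof -
      let ?K = "cball 0 R \<inter> {v. \<epsilon> \<le> infdist v ?S}"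
      have "compact ?K"
        by (intro compact_Int_closed compact_cball closed_Collect_le continuous_intros)
      moreover have "continuous_on ?K G"
        unfolding G_def
        by (intro continuous_intros nonexpansive_continuous_on[OF nonexp])
      ultimately obtain \<delta> where "0 < \<delta>" "\<And>v. v \<in> ?K \<Longrightarrow> \<delta> \<le> G v"
      proof (cases "?K = {}")
        case True
        then show ?thesis
          using that[of 1] by auto
      next
        case False
        obtain v where v: "v \<in> ?K" and min: "\<And>w. w \<in> ?K \<Longrightarrow> G v \<le> G w"
          using continuous_attains_inf[OF \<open>compact ?K\<close> False \<open>continuous_on ?K G\<close>] by blast
        have "0 < G v"
        proof (rule ccontr)
          assume "\<not> 0 < G v"
          then have "norm (v - T v) \<le> 0" "T v \<bullet> e \<le> \<theta>"
            by (simp_all add: G_def less_max_iff_disj)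
          then have "v \<in> ?S"
            by (intro S_I) auto
          then show False
            using v \<epsilon> by simp
        qed
        then show ?thesis
          using that min by blast
      qed
      then show thesis
        using that R by auto
    qed
    \<comment> \<open>The range of \<open>T\<close> is bounded, so the objective can undershoot
      \<open>\<theta>\<close> by at most \<open>C\<close>.\<close>
    define C where "C = B * norm e + \<bar>\<theta>\<bar>"
    have C0: "0 \<le> C"
      using B0 by (simp add: C_def)
    have C: "- C \<le> T v \<bullet> e - \<theta>" for v
    proof -
      have "\<bar>T v \<bullet> e\<bar> \<le> norm (T v) * norm e"
        by (rule Cauchy_Schwarz_ineq2)
      also have "\<dots> \<le> B * norm e"
        using B by (intro mult_right_mono) auto
      finally show ?thesis
        by (simp add: C_def)
    qed
    have lim: "\<forall>\<^sub>F n in sequentially. lam (Suc n) * c < b" if "0 < b" for b c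
    proof -
      have "(\<lambda>n. lam (Suc n) * c) \<longlonglongrightarrow> 0 * c"
        using lam(2) by (intro tendsto_intros filterlim_compose[OF _ filterlim_Suc])
      then show ?thesis
        using that by (simp add: order_tendsto_iff)
    qed
    have "0 < \<kappa> * \<delta>\<^sup>2"
      using \<kappa> \<delta> by simp
    \<comment> \<open>The conditions serve, in order, to limit a single move to
      \<open>\<epsilon>\<close>, to absorb the quadratic error of \<open>step2\<close>, and to let a
      large displacement outweigh both a gain \<open>2 * C\<close> from the objective and the
      desired decrease.\<close>
    then have "\<forall>\<^sub>F n in sequentially. lam (Suc n) * norm e < \<epsilon> \<and> lam (Suc n) * (norm e)\<^sup>2 < \<delta>
        \<and> lam (Suc n) * (2 * C + 2 * \<delta>) < \<kappa> * \<delta>\<^sup>2"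
      using lim \<epsilon> \<delta> by (intro eventually_conj) auto
    then obtain n0 where n0: "\<And>n. n0 \<le> n \<Longrightarrow> lam (Suc n) * norm e < \<epsilon>"
      "\<And>n. n0 \<le> n \<Longrightarrow> lam (Suc n) * (norm e)\<^sup>2 < \<delta>"
      "\<And>n. n0 \<le> n \<Longrightarrow> lam (Suc n) * (2 * C + 2 * \<delta>) < \<kappa> * \<delta>\<^sup>2"
      unfolding eventually_sequentially by blast
    have decr: "(?d (Suc n))\<^sup>2 \<le> (?d n)\<^sup>2 - \<delta> * lam (Suc n)" if n: "n0 \<le> n" "\<epsilon> \<le> ?d n" for n
    proof -
      let ?l = "lam (Suc n)"
      have l: "0 \<le> ?l"
        using lam(1) by simp
      have sq: "?l\<^sup>2 * (norm e)\<^sup>2 \<le> ?l * \<delta>"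
        using mult_left_mono[OF less_imp_le[OF n0(2)[OF n(1)]] l] by (simp add: power2_eq_square mult.assoc)
      from G[OF n(2)] consider "\<delta> \<le> norm (z n - T (z n))" | "\<delta> \<le> T (z n) \<bullet> e - \<theta>"
        by (auto simp: G_def max_def split: if_splits)
      then show ?thesis
      proof cases
        case 1
        then have "\<kappa> * \<delta>\<^sup>2 \<le> \<kappa> * (norm (z n - T (z n)))\<^sup>2"
          using \<kappa> \<delta> by (intro mult_left_mono power_mono) auto
        moreover have "2 * ?l * (- C) \<le> 2 * ?l * (T (z n) \<bullet> e - \<theta>)"
          using l C by (intro mult_left_mono) auto
        ultimately have "(?d (Suc n))\<^sup>2 \<le> (?d n)\<^sup>2 - \<kappa> * \<delta>\<^sup>2 + 2 * ?l * C + ?l * \<delta>"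
          using step2[of n] sq by linarith
        also have "\<dots> \<le> (?d n)\<^sup>2 - \<delta> * ?l"
          using n0(3)[OF n(1)] by (simp add: algebra_simps)
        finally show ?thesis .
      next
        case 2
        have "2 * ?l * \<delta> \<le> 2 * ?l * (T (z n) \<bullet> e - \<theta>)"
          using l 2 by (intro mult_left_mono) auto
        moreover have "0 \<le> \<kappa> * (norm (z n - T (z n)))\<^sup>2"
          using \<kappa> by simp
        ultimately show ?thesis
          using step2[of n] sq by (simp add: algebra_simps)
      qed
    qed
    have "\<exists>n1\<ge>n0. ?d n1 < \<epsilon>"
    proof (rule ccontr)
      assume "\<not> ?thesis"
      then have ge: "\<And>n. n0 \<le> n \<Longrightarrow> \<epsilon> \<le> ?d n"
        by force
      \<comment> \<open>By \<open>decr\<close> the quantity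
        \<open>(?d n)\<^sup>2 + \<delta> * (\<Sum>k=1..n. lam k)\<close> never rises above its value
        at \<open>n0\<close>, which contradicts the divergence of the sum.\<close>
      let ?b = "(?d n0)\<^sup>2 + \<delta> * (\<Sum>k=1..n0. lam k)"
      have ub: "(?d n)\<^sup>2 + \<delta> * (\<Sum>k=1..n. lam k) \<le> ?b" if "n0 \<le> n" for n
        using that
      proof (induction n rule: dec_induct)
        case (step n)
        then show ?case
          using decr[of n] ge[of n] by (simp add: algebra_simps)
      qed simp
      have "\<forall>\<^sub>F n in sequentially. ?b / \<delta> < (\<Sum>k=1..n. lam k)"
        using lam(3) by (simp add: filterlim_at_top_dense)
      then obtain n where n: "n0 \<le> n" "?b / \<delta> < (\<Sum>k=1..n. lam k)"
        unfolding eventually_sequentially by (meson nle_le)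
      have "?b < \<delta> * (\<Sum>k=1..n. lam k)"
        using n(2) \<delta> by (simp add: pos_divide_less_eq mult.commute)
      then show False
        using ub[OF n(1)] zero_le_power2[of "?d n"] by linarith
    qed
    then obtain n1 where n1: "n0 \<le> n1" "?d n1 < \<epsilon>"
      by blast
    \<comment> \<open>At distance at least \<open>\<epsilon>\<close> the next iterate is no farther
      away; from below \<open>\<epsilon>\<close> one move reaches at most
      \<open>2 * \<epsilon>\<close>.\<close>
    have "?d n \<le> 2 * \<epsilon>" if "n1 \<le> n" for n
      using that
    proof (induction n rule: dec_induct)
      case base
      then show ?case using n1 \<epsilon> by simp
    next
      case (step n)
      have n: "n0 \<le> n"
        using step n1 by simp
      show ?case
      proof (cases "\<epsilon> \<le> ?d n")
        case True
        have "0 \<le> \<delta> * lam (Suc n)"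
          using \<delta> lam(1) by simp
        then have "(?d (Suc n))\<^sup>2 \<le> (?d n)\<^sup>2"
          using decr[OF n True] by linarith
        then have "?d (Suc n) \<le> ?d n"
          using infdist_nonneg power2_le_imp_le by blast
        then show ?thesis
          using step.IH by linarith
      next
        case False
        then show ?thesis
          using step1[of n] n0(1)[OF n] by linarith
      qed
    qed
    then show ?thesis
      unfolding eventually_sequentially by blast
  qed
  show ?thesis
  proof (rule tendstoI)
    fix r :: real
    assume "0 < r"
    then have "\<forall>\<^sub>F n in sequentially. ?d n \<le> 2 * (r / 3)"
      by (intro main) simp
    then show "\<forall>\<^sub>F n in sequentially. dist (?d n) 0 < r"
      by eventually_elim (use \<open>0 < r\<close> in \<open>auto simp: infdist_nonneg\<close>)
  qed
qed

section \<open>Duality for the hinge loss\<close>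

text \<open>
  Fermat's rule for a composition with a linear map, obtained by separating the strict epigraph
  of \<open>\<phi>\<close> from the horizontal affine set through the minimum.
\<close>

lemma subgradient_at_composite_minimum:
  fixes A :: "'a::euclidean_space \<Rightarrow> 'b::euclidean_space" and \<phi> :: "'b \<Rightarrow> real"
  assumes lin: "linear A" and cvx: "convex_on UNIV \<phi>" and min: "\<And>q. \<phi> (A p) \<le> \<phi> (A q)"
  obtains v where "subgradient \<phi> (A p) v" "\<And>q. v \<bullet> A q = 0"
proof -
  define m where "m = \<phi> (A p)"
  let ?C = "{(u, s). \<phi> u < s}" and ?D = "range (\<lambda>q. (A q, m))"
  have "convex ?C"
  proof (rule convexI, clarsimp)
    fix u s u' s' and a b :: real
    assume h: "\<phi> u < s" "\<phi> u' < s'" "0 \<le> a" "0 \<le> b" "a + b = 1"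
    have "\<phi> (a *\<^sub>R u + b *\<^sub>R u') \<le> a * \<phi> u + b * \<phi> u'"
      using cvx h by (auto simp: convex_on_def)
    also have "\<dots> < a * s + b * s'"
    proof (cases "a = 0")
      case False
      then have "a * \<phi> u < a * s" "b * \<phi> u' \<le> b * s'"
        using h by (auto intro!: mult_left_mono)
      then show ?thesis
        by linarith
    qed (use h in auto)
    finally show "\<phi> (a *\<^sub>R u + b *\<^sub>R u') < a * s + b * s'" .
  qed
  moreover have "convex ?D"
  proof (rule convexI)
    fix d d' and a b :: real
    assume "d \<in> ?D" "d' \<in> ?D" and h: "0 \<le> a" "0 \<le> b" "a + b = 1"
    then obtain q q' where "d = (A q, m)" "d' = (A q', m)"
      by auto
    then have "a *\<^sub>R d + b *\<^sub>R d' = (A (a *\<^sub>R q + b *\<^sub>R q'), m)"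
      using h by (simp add: linear_add[OF lin] linear_scale[OF lin] flip: distrib_right)
    then show "a *\<^sub>R d + b *\<^sub>R d' \<in> ?D"
      by blast
  qed
  moreover have "(A p, m + 1) \<in> ?C"
    by (simp add: m_def)
  moreover have "\<not> \<phi> (A q) < m" for q
    using min[of q] by (simp add: m_def)
  then have "?C \<inter> ?D = {}"
    by auto
  ultimately obtain a' b where a': "a' \<noteq> 0" and C: "\<forall>x\<in>?C. a' \<bullet> x \<le> b" and D: "\<forall>x\<in>?D. b \<le> a' \<bullet> x"
    using separating_hyperplane_sets[of ?C ?D] by blast
  obtain a c where ac: "a' = (a, c)"
    by force
  have D: "b \<le> a \<bullet> A q + c * m" for q
    using D by (auto simp: ac)
  have C: "a \<bullet> u + c * s \<le> b" if "\<phi> u < s" for u s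
    using C that by (auto simp: ac)
  \<comment> \<open>A linear functional bounded below on a subspace vanishes there; \<open>t\<close>
    is chosen so as to violate the bound \<open>D\<close> by 1.\<close>
  have aA: "a \<bullet> A q = 0" for q
  proof (rule ccontr)
    assume h: "a \<bullet> A q \<noteq> 0"
    define t where "t = (b - c * m - 1) / (a \<bullet> A q)"
    have "a \<bullet> A (t *\<^sub>R q) = b - c * m - 1"
      using h by (simp add: t_def linear_scale[OF lin])
    then show False
      using D[of "t *\<^sub>R q"] by simp
  qed
  have bc: "b \<le> c * m"
    using D[of p] aA by simp
  \<comment> \<open>Passage from the strict epigraph to the graph, letting \<open>s\<close> decrease
    to \<open>\<phi> u\<close>.\<close>
  have C': "a \<bullet> u + c * \<phi> u \<le> b" for u
  proof (rule tendsto_upperbound)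
    show "((\<lambda>s. a \<bullet> u + c * s) \<longlongrightarrow> a \<bullet> u + c * \<phi> u) (at_right (\<phi> u))"
      by (intro tendsto_intros)
    show "\<forall>\<^sub>F s in at_right (\<phi> u). a \<bullet> u + c * s \<le> b"
      using C by (intro eventually_at_rightI[of "\<phi> u" "\<phi> u + 1"]) auto
  qed simp
  have "c \<le> 0"
    using C[of "A p" "m + 1"] bc aA by (simp add: m_def algebra_simps)
  \<comment> \<open>The hyperplane is not vertical: \<open>\<phi>\<close> is finite everywhere, so
    \<open>u = a\<close> may be inserted. Dividing by \<open>- c\<close> then turns the normal
    vector into a subgradient.\<close>
  moreover have "c \<noteq> 0"
  proof
    assume "c = 0"
    then have "a \<bullet> a \<le> 0"
      using C'[of a] bc by simp
    then have "a \<bullet> a = 0"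
      using inner_ge_zero[of a] by linarith
    then show False
      using a' \<open>c = 0\<close> by (simp add: ac zero_prod_def)
  qed
  ultimately have c: "c < 0"
    by simp
  let ?v = "(- 1 / c) *\<^sub>R a"
  have "subgradient \<phi> (A p) ?v"
    unfolding subgradient_def
  proof
    fix u
    have "c * \<phi> u \<le> c * m - a \<bullet> u"
      using C'[of u] bc by linarith
    then have "m - (a \<bullet> u) / c \<le> \<phi> u"
      using c by (simp add: field_simps)
    then show "\<phi> (A p) + ?v \<bullet> (u - A p) \<le> \<phi> u"
      using aA by (simp add: m_def inner_diff_right)
  qed
  then show thesis
    using that[of ?v] aA by simp
qed

section \<open>The hinge loss as a convex Lipschitz function of the margins\<close>

definition margin_map ::
  "('m::finite \<Rightarrow> real ^ 'n::finite) \<Rightarrow> ('m \<Rightarrow> 'k::{card2,linorder}) \<Rightarrow> ('n, 'k) H1 \<Rightarrow> ('k, 'm) H2" where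
  "margin_map x y p = (\<chi> i. A_op x y i p)"

text \<open>The function \<open>\<phi>\<close> whose composition with \<open>margin_map x y\<close>
  is the hinge loss; \<open>f_fun y\<close> is the same function with an additional argument that it
  ignores.\<close>

definition hinge_sum :: "('m::finite \<Rightarrow> 'k::{card2,linorder}) \<Rightarrow> ('k, 'm) H2 \<Rightarrow> real" where
  "hinge_sum y u = (\<Sum>i\<in>UNIV. h_fun y i (u $ i))"

lemma weight_simps [simp]:
  "weight (p + q) j = weight p j + weight q j" "weight (p - q) j = weight p j - weight q j"
  "weight (c *\<^sub>R p) j = c *\<^sub>R weight p j" "weight 0 j = 0"
  by (simp_all add: weight_def)

lemma bias_simps [simp]:
  "bias (p + q) j = bias p j + bias q j" "bias (p - q) j = bias p j - bias q j"
  "bias (c *\<^sub>R p) j = c * bias p j" "bias 0 j = 0"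
  by (simp_all add: bias_def)

lemma margin_map_nth:
  "margin_map x y p $ i $ j = (weight p j - weight p (y i)) \<bullet> x i + (bias p j - bias p (y i))"
  by (simp add: margin_map_def A_op_def)

lemma linear_margin_map: "linear (margin_map x y)"
  by (rule linearI) (simp_all add: vec_eq_iff margin_map_nth inner_simps algebra_simps)

lemma h_fun_ge: "(if j = y i then 0 else 1) + \<xi> $ j \<le> h_fun y i \<xi>"
  unfolding h_fun_def by (rule Max_ge) auto

lemma h_fun_le_iff: "h_fun y i \<xi> \<le> b \<longleftrightarrow> (\<forall>j. (if j = y i then 0 else 1) + \<xi> $ j \<le> b)"
  unfolding h_fun_def by (subst Max_le_iff) auto

lemma convex_on_h_fun: "convex_on UNIV (h_fun y i)"
proof (rule convex_onI)
  fix t :: real and \<xi> \<eta> assume t: "0 < t" "t < 1"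
  show "h_fun y i ((1 - t) *\<^sub>R \<xi> + t *\<^sub>R \<eta>) \<le> (1 - t) * h_fun y i \<xi> + t * h_fun y i \<eta>"
    unfolding h_fun_le_iff
  proof
    fix j
    let ?r = "if j = y i then 0 else 1 :: real"
    have "(1 - t) * (?r + \<xi> $ j) + t * (?r + \<eta> $ j) \<le> (1 - t) * h_fun y i \<xi> + t * h_fun y i \<eta>"
      using t h_fun_ge[of j y i] by (intro add_mono mult_left_mono) auto
    then show "?r + ((1 - t) *\<^sub>R \<xi> + t *\<^sub>R \<eta>) $ j \<le> (1 - t) * h_fun y i \<xi> + t * h_fun y i \<eta>"
      by (simp add: algebra_simps split: if_splits)
  qed
qed simp

lemma h_fun_Lipschitz: "h_fun y i \<xi> \<le> h_fun y i \<eta> + norm (\<xi> - \<eta>)"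
  unfolding h_fun_le_iff
proof
  fix j
  have "\<bar>(\<xi> - \<eta>) $ j\<bar> \<le> norm (\<xi> - \<eta>)"
    by (rule component_le_norm_cart)
  then show "(if j = y i then 0 else 1) + \<xi> $ j \<le> h_fun y i \<eta> + norm (\<xi> - \<eta>)"
    using h_fun_ge[of j y i \<eta>] by (simp split: if_splits)
qed

lemma convex_on_hinge_sum: "convex_on UNIV (hinge_sum y)"
proof (rule convex_onI)
  fix t :: real and u w :: "('a, 'b) H2" assume t: "0 < t" "t < 1"
  have "hinge_sum y ((1 - t) *\<^sub>R u + t *\<^sub>R w)
      \<le> (\<Sum>i\<in>UNIV. (1 - t) * h_fun y i (u $ i) + t * h_fun y i (w $ i))"
    unfolding hinge_sum_def
    using t by (intro sum_mono) (simp add: convex_onD[OF convex_on_h_fun])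
  then show "hinge_sum y ((1 - t) *\<^sub>R u + t *\<^sub>R w) \<le> (1 - t) * hinge_sum y u + t * hinge_sum y w"
    by (simp add: hinge_sum_def sum.distrib sum_distrib_left)
qed simp

lemma norm_vec_power2: "(norm u)\<^sup>2 = (\<Sum>i\<in>UNIV. (norm (u $ i))\<^sup>2)"
  by (simp add: norm_vec_def L2_set_def sum_nonneg)

text \<open>Cauchy--Schwarz; this is the source of the Lipschitz constant \<open>sqrt M\<close> and
  of the bound on dual certificates.\<close>

lemma sum_norm_nth_le:
  fixes u :: "'a::real_normed_vector ^ 'm::finite"
  shows "(\<Sum>i\<in>UNIV. norm (u $ i)) \<le> sqrt (real CARD('m)) * norm u"
proof (rule power2_le_imp_le)
  show "(\<Sum>i\<in>UNIV. norm (u $ i))\<^sup>2 \<le> (sqrt (real CARD('m)) * norm u)\<^sup>2"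
    using sum_squared_le_sum_of_squares[of "\<lambda>i. norm (u $ i)" UNIV]
    by (simp add: power_mult_distrib norm_vec_power2 mult.commute)
qed simp

lemma hinge_sum_Lipschitz:
  fixes u w :: "('k::{card2,linorder}, 'm::finite) H2"
  shows "\<bar>hinge_sum y u - hinge_sum y w\<bar> \<le> sqrt (real CARD('m)) * norm (u - w)"
proof -
  have *: "hinge_sum y u - hinge_sum y w \<le> sqrt (real CARD('m)) * norm (u - w)"
    for u w :: "('k, 'm) H2"
  proof -
    have "hinge_sum y u - hinge_sum y w = (\<Sum>i\<in>UNIV. h_fun y i (u $ i) - h_fun y i (w $ i))"
      by (simp add: hinge_sum_def sum_subtractf)
    also have "\<dots> \<le> (\<Sum>i\<in>UNIV. norm ((u - w) $ i))"
      using h_fun_Lipschitz by (intro sum_mono) (simp add: algebra_simps)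
    also have "\<dots> \<le> sqrt (real CARD('m)) * norm (u - w)"
      by (rule sum_norm_nth_le)
    finally show ?thesis .
  qed
  show ?thesis
    using *[of u w] *[of w u] by (simp add: norm_minus_commute)
qed

text \<open>The entry at the label \<open>y i\<close> has margin 0 and offset 0, and so contributes
  the outer maximum with 0.\<close>

lemma hinge_loss_eq:
  fixes y :: "'m::finite \<Rightarrow> 'k::{card2,linorder}"
  shows "hinge_loss x y p = hinge_sum y (margin_map x y p)"
  unfolding hinge_loss_def hinge_sum_def
proof (rule sum.cong)
  fix i
  let ?g = "\<lambda>s. 1 - ((weight p (y i) - weight p s) \<bullet> x i + (bias p (y i) - bias p s))"
  let ?h = "h_fun y i (margin_map x y p $ i)"
  have g: "?g s = 1 + margin_map x y p $ i $ s" for s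
    by (simp add: margin_map_nth inner_simps)
  have ne: "UNIV - {y i} \<noteq> {}"
    using two_le_card[where 'a = 'k] card_mono[of "{y i}" UNIV] by fastforce
  show "max 0 (MAX s\<in>UNIV - {y i}. ?g s) = ?h"
  proof (rule antisym)
    have "?g s \<le> ?h" if "s \<noteq> y i" for s
      using h_fun_ge[of s y i "margin_map x y p $ i"] that by (simp only: g if_False)
    moreover have "0 \<le> ?h"
      using h_fun_ge[of "y i" y i "margin_map x y p $ i"] by (simp add: margin_map_nth)
    ultimately show "max 0 (MAX s\<in>UNIV - {y i}. ?g s) \<le> ?h"
      using ne by simp
    show "?h \<le> max 0 (MAX s\<in>UNIV - {y i}. ?g s)"
      unfolding h_fun_le_iff
    proof
      fix j
      show "(if j = y i then 0 else 1) + margin_map x y p $ i $ j \<le> max 0 (MAX s\<in>UNIV - {y i}. ?g s)"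
      proof (cases "j = y i")
        case False
        then have "?g j \<le> (MAX s\<in>UNIV - {y i}. ?g s)"
          by (intro Max_ge) auto
        with False show ?thesis
          by (simp add: g le_max_iff_disj del: Max_ge_iff)
      qed (simp add: margin_map_nth)
    qed
  qed
qed simp

lemma hinge_minimizers_iff:
  "p \<in> hinge_minimizers x y \<longleftrightarrow>
     (\<forall>q. hinge_sum y (margin_map x y p) \<le> hinge_sum y (margin_map x y q))"
  by (simp add: hinge_minimizers_def argmin_set_iff hinge_loss_eq)

text \<open>The optimality condition for \<open>\<phi> \<circ> A\<close>: the second conjunct says
  that the adjoint of \<open>margin_map x y\<close> annihilates \<open>v\<close>.\<close>

definition dual_certificate ::
  "('m::finite \<Rightarrow> real ^ 'n::finite) \<Rightarrow> ('m \<Rightarrow> 'k::{card2,linorder}) \<Rightarrow> ('n, 'k) H1 \<Rightarrow> ('k, 'm) H2 \<Rightarrow> bool"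
  where
  "dual_certificate x y p v \<longleftrightarrow>
     subgradient (hinge_sum y) (margin_map x y p) v \<and> (\<forall>q. v \<bullet> margin_map x y q = 0)"

lemma dual_certificate_imp_minimizer:
  assumes "dual_certificate x y p v"
  shows "p \<in> hinge_minimizers x y"
  unfolding hinge_minimizers_iff
proof
  fix q
  have "hinge_sum y (margin_map x y p) + v \<bullet> (margin_map x y q - margin_map x y p)
      \<le> hinge_sum y (margin_map x y q)"
    using assms unfolding dual_certificate_def subgradient_def by blast
  moreover have "v \<bullet> margin_map x y q = 0" "v \<bullet> margin_map x y p = 0"
    using assms unfolding dual_certificate_def by blast+
  ultimately show "hinge_sum y (margin_map x y p) \<le> hinge_sum y (margin_map x y q)"
    by (simp add: inner_diff_right)
qed

lemma minimizer_imp_dual_certificate: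
  assumes "p \<in> hinge_minimizers x y"
  obtains v where "dual_certificate x y p v"
  using subgradient_at_composite_minimum[OF linear_margin_map convex_on_hinge_sum, of y x y p] assms
  unfolding hinge_minimizers_iff dual_certificate_def by blast

text \<open>Minimizers share the value of \<open>hinge_sum\<close>, and \<open>v\<close> is
  orthogonal to the margins of both, so the subgradient inequality reads the same at either
  point.\<close>

lemma dual_certificate_transfer:
  assumes v: "dual_certificate x y p v" and q: "q \<in> hinge_minimizers x y"
  shows "dual_certificate x y q v"
proof -
  have "hinge_sum y (margin_map x y q) = hinge_sum y (margin_map x y p)"
    using q dual_certificate_imp_minimizer[OF v] unfolding hinge_minimizers_iff by (meson antisym)
  moreover have "v \<bullet> margin_map x y q = 0" "v \<bullet> margin_map x y p = 0"
    using v unfolding dual_certificate_def by blast+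
  ultimately show ?thesis
    using v unfolding dual_certificate_def subgradient_def inner_diff_right by metis
qed

text \<open>The subgradient inequality is tested at \<open>?u + v\<close>, in the direction of the
  subgradient itself.\<close>

lemma norm_dual_certificate:
  fixes x :: "'m::finite \<Rightarrow> real ^ 'n::finite"
  assumes "dual_certificate x y p v"
  shows "norm v \<le> sqrt (real CARD('m))"
proof -
  let ?u = "margin_map x y p"
  have "hinge_sum y ?u + v \<bullet> (?u + v - ?u) \<le> hinge_sum y (?u + v)"
    using assms unfolding dual_certificate_def subgradient_def by blast
  then have "v \<bullet> v \<le> hinge_sum y (?u + v) - hinge_sum y ?u"
    by simp
  also have "\<dots> \<le> sqrt (real CARD('m)) * norm v"
    using hinge_sum_Lipschitz[of y "?u + v" ?u] by simp
  finally have "norm v * norm v \<le> sqrt (real CARD('m)) * norm v"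
    by (simp add: power2_norm_eq_inner flip: power2_eq_square)
  then show ?thesis
    by (cases "v = 0") simp_all
qed

section \<open>Fixed points of the Douglas--Rachford operator\<close>

lemma null_A_eq: "null_A x y = {(p, u). u = margin_map x y p}"
  by (auto simp: null_A_def A_check_def margin_map_def)

lemma subspace_null_A: "subspace (null_A x y)"
  unfolding null_A_eq subspace_def
  using linear_margin_map[of x y] by (auto simp: zero_prod_def linear_0 linear_add linear_scale)

lemma f_fun_eq: "f_fun y w = hinge_sum y (snd w)"
  by (simp add: f_fun_def hinge_sum_def case_prod_beta)

lemma convex_on_f_fun: "convex_on UNIV (f_fun y)"
  by (rule convex_onI) (simp_all add: f_fun_eq convex_onD[OF convex_on_hinge_sum])

lemma f_fun_Lipschitz:
  fixes v w :: "('n::finite, 'k::{card2,linorder}, 'm::finite) X"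
  shows "\<bar>f_fun y v - f_fun y w\<bar> \<le> sqrt (real CARD('m)) * norm (v - w)"
proof -
  have "\<bar>f_fun y v - f_fun y w\<bar> \<le> sqrt (real CARD('m)) * norm (snd (v - w))"
    using hinge_sum_Lipschitz[of y "snd v" "snd w"] by (simp add: f_fun_eq)
  also have "\<dots> \<le> sqrt (real CARD('m)) * norm (v - w)"
    by (intro mult_left_mono) (metis norm_snd_le prod.collapse, simp)
  finally show ?thesis .
qed

lemma subgradient_f_fun_iff:
  "subgradient (f_fun y) (p, u) (g, v) \<longleftrightarrow> g = 0 \<and> subgradient (hinge_sum y) u v"
proof
  assume s: "subgradient (f_fun y) (p, u) (g, v)"
  have s': "hinge_sum y u + (g \<bullet> (q - p) + v \<bullet> (w - u)) \<le> hinge_sum y w" for q w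
    using s unfolding subgradient_def f_fun_eq by auto
  have "g \<bullet> g \<le> 0"
    using s'[of "p + g" u] by simp
  then have "g \<bullet> g = 0"
    using inner_ge_zero[of g] by linarith
  then have "g = 0"
    by simp
  then show "g = 0 \<and> subgradient (hinge_sum y) u v"
    using s'[of p] by (simp add: subgradient_def)
qed (auto simp: subgradient_def f_fun_eq)

text \<open>
  A fixed point is \<open>(p, A p - v)\<close> with a minimizer \<open>p\<close> and a dual solution \<open>v\<close>, because \<open>f\<close> does not
  depend on its first argument.
\<close>

lemma Fix_T_DRS_iff:
  "(p, u) \<in> Fix (T_DRS x y) \<longleftrightarrow> dual_certificate x y p (margin_map x y p - u)"
proof -
  let ?A = "margin_map x y" and ?N = "null_A x y"
  let ?w = "closest_point ?N (p, u)"
  have N: "closed ?N" "convex ?N" "?N \<noteq> {}"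
    using subspace_null_A closed_subspace subspace_imp_convex subspace_0 by blast+
  have cp: "?w = w \<longleftrightarrow> w \<in> ?N \<and> (\<forall>q. ((p, u) - w) \<bullet> (q, ?A q) = 0)" for w
    unfolding closest_point_subspace_iff[OF subspace_null_A] by (auto simp: null_A_eq)
  \<comment> \<open>For \<open>z = (p, u)\<close> the equation is
    \<open>2 prox (2 w - z) - (2 w - z) = z\<close> with \<open>w\<close> the projection
    \<open>?w\<close>. The terms \<open>z\<close> cancel, leaving \<open>prox (2 w - z) = w\<close>,
    that is, \<open>w - z\<close> is a subgradient at \<open>w\<close>.\<close>
  have "(p, u) \<in> Fix (T_DRS x y) \<longleftrightarrow>
      2 *\<^sub>R prox (\<lambda>w. ereal (f_fun y w)) (2 *\<^sub>R ?w - (p, u)) = 2 *\<^sub>R ?w"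
    unfolding Fix_def T_DRS_def prox_indicator_fun[OF N] by (simp add: diff_diff_eq2 diff_eq_eq)
  also have "\<dots> \<longleftrightarrow> prox (\<lambda>w. ereal (f_fun y w)) (2 *\<^sub>R ?w - (p, u)) = ?w"
    by (simp only: scaleR_cancel_left) simp
  also have "\<dots> \<longleftrightarrow> subgradient (f_fun y) ?w (?w - (p, u))"
    unfolding prox_eq_iff_subgradient[OF convex_on_f_fun f_fun_Lipschitz] by (simp add: scaleR_2)
  also have "\<dots> \<longleftrightarrow> dual_certificate x y p (?A p - u)"
  proof
    assume s: "subgradient (f_fun y) ?w (?w - (p, u))"
    obtain q where q: "?w = (q, ?A q)" and o: "\<And>q'. ((p, u) - ?w) \<bullet> (q', ?A q') = 0"
      using cp[of ?w] by (auto simp: null_A_eq)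
    have "q = p" and s': "subgradient (hinge_sum y) (?A p) (?A p - u)"
      using s unfolding q by (auto simp: subgradient_f_fun_iff)
    moreover have "(?A p - u) \<bullet> ?A q' = 0" for q'
      using o[of q'] unfolding q \<open>q = p\<close> by (simp add: inner_diff_left)
    ultimately show "dual_certificate x y p (?A p - u)"
      by (simp add: dual_certificate_def)
  next
    assume d: "dual_certificate x y p (?A p - u)"
    then have "?w = (p, ?A p)"
      unfolding cp by (auto simp: null_A_eq dual_certificate_def inner_diff_left)
    then show "subgradient (f_fun y) ?w (?w - (p, u))"
      using d by (simp add: subgradient_f_fun_iff dual_certificate_def)
  qed
  finally show ?thesis .
qed

text \<open>The residual has first component 0 and second component orthogonal to the range of
  \<open>margin_map x y\<close>, hence it is orthogonal to the graph. The constraints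
  \<open>L_set\<close> thereby refer to the weights of \<open>p\<close> itself.\<close>

lemma closest_point_null_A:
  assumes "dual_certificate x y p (margin_map x y p - u)"
  shows "closest_point (null_A x y) (p, u) = (p, margin_map x y p)"
  unfolding closest_point_subspace_iff[OF subspace_null_A]
  using assms by (auto simp: null_A_eq dual_certificate_def inner_diff_left)

lemma nonexpansive_comp:
  assumes "nonexpansive S" "nonexpansive T"
  shows "nonexpansive (S \<circ> T)"
  using assms unfolding nonexpansive_def comp_def by (meson order_trans)

lemma nonexpansive_T_DRS: "nonexpansive (T_DRS x y)"
proof -
  let ?N = "null_A x y"
  have N: "closed ?N" "convex ?N" "?N \<noteq> {}"
    using subspace_null_A closed_subspace subspace_imp_convex subspace_0 by blast+
  have Rg: "nonexpansive (\<lambda>v. 2 *\<^sub>R prox (indicator_fun ?N) v - v)"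
    unfolding prox_indicator_fun[OF N] by (intro nonexpansive_reflection averaged_with_closest_point N)
  have "nonexpansive (\<lambda>v. 2 *\<^sub>R prox (\<lambda>w. ereal (f_fun y w)) v - v)"
    by (intro nonexpansive_reflection averaged_with_prox[OF convex_on_f_fun f_fun_Lipschitz])
  then show ?thesis
    unfolding T_DRS_def using Rg by (rule nonexpansive_comp)
qed

section \<open>Size of the margins in terms of the parameters\<close>

lemma norm_nth_diff_power2_le:
  fixes p :: "('a::real_inner) ^ 'k::finite"
  shows "(norm (p $ j - p $ s))\<^sup>2 \<le> 2 * (norm p)\<^sup>2"
proof (cases "j = s")
  case False
  have "(norm (p $ j - p $ s))\<^sup>2 + (norm (p $ j + p $ s))\<^sup>2 = 2 * ((norm (p $ j))\<^sup>2 + (norm (p $ s))\<^sup>2)"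
    unfolding power2_norm_eq_inner by (simp add: inner_simps)
  moreover have "(\<Sum>i\<in>{j, s}. (norm (p $ i))\<^sup>2) \<le> (norm p)\<^sup>2"
    unfolding norm_vec_power2 by (intro sum_mono2) auto
  then have "(norm (p $ j))\<^sup>2 + (norm (p $ s))\<^sup>2 \<le> (norm p)\<^sup>2"
    using False by simp
  ultimately show ?thesis
    using zero_le_power2[of "norm (p $ j + p $ s)"] by (smt (verit))
qed simp

text \<open>Cauchy--Schwarz with the augmented sample \<open>(x i, 1)\<close>, whose squared norm is
  at most \<open>\<Upsilon>\<^sup>2 + 1\<close>.\<close>

lemma margin_map_nth_power2_le:
  assumes "norm (x i) \<le> \<Upsilon>"
  shows "(margin_map x y p $ i $ j)\<^sup>2 \<le> 2 * (norm p)\<^sup>2 * (\<Upsilon>\<^sup>2 + 1)"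
proof -
  let ?d = "p $ j - p $ y i"
  have "margin_map x y p $ i $ j = ?d \<bullet> (x i, 1)"
    by (simp add: margin_map_nth weight_def bias_def inner_prod_def)
  also have "(?d \<bullet> (x i, 1))\<^sup>2 \<le> (norm ?d)\<^sup>2 * (norm (x i, 1 :: real))\<^sup>2"
    unfolding power2_norm_eq_inner by (rule Cauchy_Schwarz_ineq)
  also have "(norm (x i, 1 :: real))\<^sup>2 = (norm (x i))\<^sup>2 + 1"
    by (simp add: norm_Pair)
  also have "(norm ?d)\<^sup>2 * ((norm (x i))\<^sup>2 + 1) \<le> 2 * (norm p)\<^sup>2 * (\<Upsilon>\<^sup>2 + 1)"
    using assms by (intro mult_mono norm_nth_diff_power2_le add_mono power_mono) auto
  finally show ?thesis .
qed

lemma norm_margin_map_power2_le: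
  fixes x :: "'m::finite \<Rightarrow> real ^ 'n::finite" and y :: "'m \<Rightarrow> 'k::{card2,linorder}"
  assumes "\<And>i. norm (x i) \<le> \<Upsilon>"
  shows "(norm (margin_map x y p))\<^sup>2 \<le> 2 * (real CARD('k) * real CARD('m) * (\<Upsilon>\<^sup>2 + 1) * (norm p)\<^sup>2)"
proof -
  have "(norm (margin_map x y p))\<^sup>2 = (\<Sum>i\<in>UNIV. \<Sum>j\<in>UNIV. (margin_map x y p $ i $ j)\<^sup>2)"
    by (simp add: norm_vec_power2)
  also have "\<dots> \<le> (\<Sum>i\<in>(UNIV :: 'm set). \<Sum>j\<in>(UNIV :: 'k set). 2 * (norm p)\<^sup>2 * (\<Upsilon>\<^sup>2 + 1))"
    by (intro sum_mono margin_map_nth_power2_le assms)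
  finally show ?thesis
    by (simp add: mult_ac)
qed

text \<open>
  Near the origin the hinge loss is affine along the ray through \<open>p\<close>; if every sample had an
  entry above \<open>-1\<close> at a label other than its own, it would still be affine a little beyond a minimizer \<open>p\<close>, hence constant on
  the way from \<open>0\<close> to \<open>p\<close>.
\<close>

lemma minimizer_margin_le_minus_1:
  fixes x :: "'m::finite \<Rightarrow> real ^ 'n::finite" and y :: "'m \<Rightarrow> 'k::{card2,linorder}"
  assumes p: "p \<in> hinge_minimizers x y" and 0: "0 \<notin> hinge_minimizers x y"
  obtains i where "\<And>j. j \<noteq> y i \<Longrightarrow> margin_map x y p $ i $ j \<le> - 1"
proof (rule ccontr)
  let ?a = "margin_map x y p"
  assume "\<not> thesis"
  then have ex: "\<exists>j. j \<noteq> y i \<and> - 1 < ?a $ i $ j" for i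
    using that by (meson not_less)
  \<comment> \<open>The largest margin at a foreign label. Along the ray
    \<open>t *\<^sub>R p\<close> the loss of sample \<open>i\<close> is \<open>1 + t * m i\<close>
    for as long as this is nonnegative.\<close>
  define m where "m i = (MAX j\<in>UNIV - {y i}. ?a $ i $ j)" for i
  have ne: "UNIV - {y i} \<noteq> {}" for i
    using ex by blast
  have m_ge: "?a $ i $ j \<le> m i" if "j \<noteq> y i" for i j
    unfolding m_def using that by (intro Max_ge) auto
  have m_att: "\<exists>j. j \<noteq> y i \<and> ?a $ i $ j = m i" for i
  proof -
    have "m i \<in> (\<lambda>j. ?a $ i $ j) ` (UNIV - {y i})"
      unfolding m_def using ne by (intro Max_in) auto
    then show ?thesis
      by auto
  qed
  have m: "- 1 < m i" for i
    using ex[of i] m_ge by (meson less_le_trans)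
  have h: "h_fun y i (margin_map x y (t *\<^sub>R p) $ i) = 1 + t * m i" if "0 \<le> t" "0 \<le> 1 + t * m i" for i t
  proof (rule antisym)
    have s: "margin_map x y (t *\<^sub>R p) $ i $ j = t * ?a $ i $ j" for j
      by (simp add: linear_scale[OF linear_margin_map])
    have "?a $ i $ y i = 0"
      by (simp add: margin_map_nth)
    then show "h_fun y i (margin_map x y (t *\<^sub>R p) $ i) \<le> 1 + t * m i"
      unfolding h_fun_le_iff s using that m_ge by (auto intro: mult_left_mono)
    obtain j where "j \<noteq> y i" "?a $ i $ j = m i"
      using m_att by blast
    then show "1 + t * m i \<le> h_fun y i (margin_map x y (t *\<^sub>R p) $ i)"
      using h_fun_ge[of j y i "margin_map x y (t *\<^sub>R p) $ i"] by (simp add: s)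
  qed
  have H: "hinge_sum y (margin_map x y (t *\<^sub>R p)) = real CARD('m) + t * (\<Sum>i\<in>UNIV. m i)"
    if "0 \<le> t" "\<And>i. 0 \<le> 1 + t * m i" for t
    unfolding hinge_sum_def using that by (simp add: h sum.distrib sum_distrib_left)
  \<comment> \<open>The strict bounds \<open>- 1 < m i\<close> for finitely many samples leave room
    for some \<open>t\<close> beyond 1.\<close>
  have "\<forall>\<^sub>F t in at_right 1. \<forall>i. 0 < 1 + t * m i"
  proof (intro eventually_all_finite)
    fix i
    have "((\<lambda>t. 1 + t * m i) \<longlongrightarrow> 1 + 1 * m i) (at_right 1)"
      by (intro tendsto_intros)
    then show "\<forall>\<^sub>F t in at_right 1. 0 < 1 + t * m i"
      using m[of i] by (intro order_tendstoD) auto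
  qed
  then have "\<exists>t>1. \<forall>i. 0 < 1 + t * m i"
    unfolding eventually_at_right_field by (meson dense)
  then obtain t where t: "1 < t" "\<And>i. 0 < 1 + t * m i"
    by blast
  have H0: "hinge_sum y (margin_map x y 0) = real CARD('m)"
    using H[of 0] by simp
  have "0 \<le> 1 + 1 * m i" for i
    using m[of i] by simp
  from H[OF _ this] have H1: "hinge_sum y (margin_map x y p) = real CARD('m) + (\<Sum>i\<in>UNIV. m i)"
    by simp
  have "hinge_sum y (margin_map x y (t *\<^sub>R p)) = real CARD('m) + t * (\<Sum>i\<in>UNIV. m i)"
    using t by (intro H) (auto intro: less_imp_le)
  moreover have "hinge_sum y (margin_map x y p) \<le> hinge_sum y (margin_map x y (t *\<^sub>R p))"
    using p by (simp add: hinge_minimizers_iff)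
  \<comment> \<open>Minimality of \<open>p\<close> makes the slope along the ray nonnegative, so
    going back to \<open>0\<close> does not raise the loss.\<close>
  ultimately have "0 \<le> (t - 1) * (\<Sum>i\<in>UNIV. m i)"
    using H1 by (simp add: algebra_simps)
  then have "0 \<le> (\<Sum>i\<in>UNIV. m i)"
    using t(1) by (simp add: zero_le_mult_iff)
  then have "hinge_sum y (margin_map x y 0) \<le> hinge_sum y (margin_map x y p)"
    by (simp add: H0 H1)
  then have "0 \<in> hinge_minimizers x y"
    using p unfolding hinge_minimizers_iff by (meson order_trans)
  then show False
    using 0 by blast
qed

section \<open>The feasible set and the composite operator\<close>

text \<open>All ordered pairs of labels split into those below, above and on the diagonal; the
  additive form avoids subtraction and division of naturals.\<close>

lemma two_card_label_pair: "2 * CARD('k label_pair) + CARD('k) = CARD('k::{card2,linorder})\<^sup>2"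
proof -
  let ?P = "{(r::'k, s). r < s}" and ?Q = "{(r::'k, s). s < r}" and ?D = "{(r::'k, s). r = s}"
  have 1: "CARD('k label_pair) = card ?P"
    by (rule type_definition.card[OF type_definition_label_pair])
  have "?Q = prod.swap ` ?P"
    by force
  then have 2: "card ?Q = card ?P"
    by (simp only: card_image[OF inj_swap])
  have "?D = (\<lambda>r. (r, r)) ` UNIV"
    by auto
  then have 3: "card ?D = CARD('k)"
    by (simp add: card_image inj_on_def)
  have "card (?P \<union> ?Q \<union> ?D) = card (?P \<union> ?Q) + card ?D"
    by (rule card_Un_disjoint) (auto)
  also have "card (?P \<union> ?Q) = card ?P + card ?Q"
    by (rule card_Un_disjoint) (auto)
  also have "?P \<union> ?Q \<union> ?D = UNIV \<times> UNIV"
    by (auto simp: neq_iff)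
  finally show ?thesis
    unfolding card_cartesian_product 1 2 3 power2_eq_square by simp
qed

lemma norm_weight_le: "norm (weight p j) \<le> norm p"
proof -
  have "norm (weight p j) \<le> norm (p $ j)"
    unfolding weight_def by (metis norm_fst_le prod.collapse)
  also have "\<dots> \<le> norm p"
    by (rule Finite_Cartesian_Product.norm_nth_le)
  finally show ?thesis .
qed

lemma Psi_ge: "norm (weight p (pair_fst q) - weight p (pair_snd q)) \<le> Psi p"
  unfolding Psi_def by (rule Max_ge) auto

lemma Psi_le_iff:
  "Psi p \<le> b \<longleftrightarrow> (\<forall>q. norm (weight p (pair_fst q) - weight p (pair_snd q)) \<le> b)"
  unfolding Psi_def by (subst Max_le_iff) auto

lemma Psi_nonneg: "0 \<le> Psi p"
  using Psi_ge norm_ge_zero order_trans by blast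

lemma norm_weight_diff_le: "norm (weight p r - weight p s) \<le> 2 * norm p"
  using norm_triangle_ineq4[of "weight p r" "weight p s"] norm_weight_le[of p r] norm_weight_le[of p s]
  by linarith

lemma Psi_Lipschitz:
  fixes p q :: "('n::finite, 'k::{card2,linorder}) H1"
  shows "Psi p \<le> Psi q + 2 * norm (p - q)"
  unfolding Psi_le_iff
proof
  fix l :: "'k label_pair"
  let ?d = "\<lambda>p :: ('n, 'k) H1. weight p (pair_fst l) - weight p (pair_snd l)"
  have "norm (?d p) \<le> norm (?d q) + norm (?d (p - q))"
    using norm_triangle_ineq[of "?d q" "?d (p - q)"] by simp
  also have "\<dots> \<le> Psi q + 2 * norm (p - q)"
    by (intro add_mono Psi_ge norm_weight_diff_le)
  finally show "norm (?d p) \<le> Psi q + 2 * norm (p - q)" .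
qed

lemma continuous_on_Psi: "continuous_on A Psi"
proof -
  have "\<bar>Psi p - Psi q\<bar> \<le> 2 * norm (p - q)" for p q :: "('a, 'b) H1"
    using Psi_Lipschitz[of p q] Psi_Lipschitz[of q p] by (simp add: norm_minus_commute abs_le_iff)
  then have "2-lipschitz_on A (Psi :: ('a, 'b) H1 \<Rightarrow> real)"
    by (intro lipschitz_onI) (auto simp: dist_norm)
  then show ?thesis
    by (rule lipschitz_on_continuous_on)
qed

lemma closed_hinge_minimizers:
  fixes x :: "'m::finite \<Rightarrow> real ^ 'n::finite" and y :: "'m \<Rightarrow> 'k::{card2,linorder}"
  shows "closed (hinge_minimizers x y)"
  unfolding hinge_minimizers_def
proof (rule closed_argmin_set)
  have "(sqrt (real CARD('m)))-lipschitz_on UNIV (hinge_sum y)"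
    using hinge_sum_Lipschitz by (intro lipschitz_onI) (auto simp: dist_norm)
  then have "continuous_on UNIV (hinge_sum y)"
    by (rule lipschitz_on_continuous_on)
  moreover have "continuous_on UNIV (margin_map x y)"
    using linear_margin_map by (intro linear_continuous_on) (simp add: linear_conv_bounded_linear)
  ultimately have "continuous_on UNIV (\<lambda>p. hinge_sum y (margin_map x y p))"
    by (rule continuous_on_compose2) simp
  then show "continuous_on UNIV (hinge_loss x y)"
    by (simp add: hinge_loss_eq[abs_def])
qed simp

section \<open>Closedness and convexity of the constraint sets\<close>

lemma E_set_closed_convex:
  fixes q :: "'k::{card2,linorder} label_pair"
  defines "E \<equiv> E_set q :: ('n::finite, 'k, 'm::finite) H set"
  shows "closed E" "convex E" "E \<noteq> {}"
proof -
  have E: "E = {z. norm (fst (snd (snd z)) $ q) \<le> snd (snd (snd z))}"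
    by (auto simp: E_def E_set_def)
  show "closed E"
    unfolding E by (intro closed_Collect_le continuous_intros)
  have "norm (a *\<^sub>R v + b *\<^sub>R w) \<le> a * s + b * t"
    if "norm v \<le> s" "norm w \<le> t" "0 \<le> a" "0 \<le> b" for a b s t :: real and v w :: "real ^ 'n"
  proof -
    have "norm (a *\<^sub>R v + b *\<^sub>R w) \<le> a * norm v + b * norm w"
      using norm_triangle_ineq[of "a *\<^sub>R v" "b *\<^sub>R w"] that by simp
    also have "\<dots> \<le> a * s + b * t"
      using that by (intro add_mono mult_left_mono)
    finally show ?thesis .
  qed
  then show "convex E"
    unfolding E by (intro convexI) simp
  have "0 \<in> E"
    by (simp add: E)
  then show "E \<noteq> {}"
    by blast
qed

lemma subspace_L_set:
  fixes x :: "'m::finite \<Rightarrow> real ^ 'n::finite" and y :: "'m \<Rightarrow> 'k::{card2,linorder}"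
  shows "subspace (L_set x y q)"
proof -
  define f where "f v = Omega_op q (closest_point (null_A x y) v)" for v
  define \<pi> where "\<pi> z = (fst z, fst (snd z))" for z :: "('n, 'k, 'm) H"
  have lin: "linear (closest_point (null_A x y))"
    by (rule linear_closest_point_subspace[OF subspace_null_A])
  have Om: "Omega_op q (v + w) = Omega_op q v + Omega_op q w"
    "Omega_op q (c *\<^sub>R v) = c *\<^sub>R Omega_op q v" for v w :: "('n, 'k, 'm) X" and c
    by (simp_all add: Omega_op_def case_prod_beta algebra_simps)
  have f: "f (v + w) = f v + f w" "f (c *\<^sub>R v) = c *\<^sub>R f v" for v w c
    unfolding f_def by (simp_all add: linear_add[OF lin] linear_scale[OF lin] Om)
  have \<pi>: "\<pi> (v + w) = \<pi> v + \<pi> w" "\<pi> (c *\<^sub>R v) = c *\<^sub>R \<pi> v" "\<pi> 0 = 0" for v w c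
    by (simp_all add: \<pi>_def zero_prod_def)
  have "L_set x y q = {z. fst (snd (snd z)) $ q = f (\<pi> z)}"
    by (auto simp: L_set_def f_def \<pi>_def)
  moreover have "f 0 = 0"
    using f(2)[of 0] by simp
  ultimately show ?thesis
    by (simp add: subspace_def \<pi> f)
qed

lemma L_set_closed_convex: "closed (L_set x y q)" "convex (L_set x y q)" "L_set x y q \<noteq> {}"
  using closed_subspace[OF subspace_L_set] subspace_imp_convex[OF subspace_L_set]
    subspace_0[OF subspace_L_set, of x y q] by auto

lemma B_set_closed_convex:
  assumes "0 \<le> \<rho>1" "0 \<le> \<rho>2" "0 \<le> \<rho>3" "0 \<le> \<rho>4"
  shows "closed (B_set \<rho>1 \<rho>2 \<rho>3 \<rho>4)" "convex (B_set \<rho>1 \<rho>2 \<rho>3 \<rho>4)" "B_set \<rho>1 \<rho>2 \<rho>3 \<rho>4 \<noteq> {}"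
proof -
  show "closed (B_set \<rho>1 \<rho>2 \<rho>3 \<rho>4)"
    unfolding B_set_def by (intro closed_Times closed_cball closed_real_atLeastAtMost)
  show "convex (B_set \<rho>1 \<rho>2 \<rho>3 \<rho>4)"
    unfolding B_set_def by (intro convex_Times convex_cball convex_real_interval)
  show "B_set \<rho>1 \<rho>2 \<rho>3 \<rho>4 \<noteq> {}"
    unfolding B_set_def using assms by (auto simp: Times_empty)
qed

lemma bounded_B_set: "bounded (B_set \<rho>1 \<rho>2 \<rho>3 \<rho>4)"
  unfolding B_set_def by (intro bounded_Times bounded_cball bounded_closed_interval)

section \<open>Averagedness and fixed points of the composite operator\<close>

lemma averaged_nonexpansive_T_DRS_relaxed:
  fixes x :: "'m::finite \<Rightarrow> real ^ 'n::finite" and y :: "'m \<Rightarrow> 'k::{card2,linorder}"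
  assumes "0 < \<alpha>" "\<alpha> < 1"
  shows "averaged_nonexpansive (T_DRS_relaxed x y \<alpha>)"
proof -
  define R :: "('n, 'k, 'm) H \<Rightarrow> ('n, 'k, 'm) H" where
    "R = (\<lambda>(p, u, \<omega>, t). let (p', u') = T_DRS x y (p, u) in (p', u', \<omega>, t))"
  have "norm (R z - R z') \<le> norm (z - z')" for z z'
  proof -
    obtain p u \<omega> t where z: "z = (p, u, \<omega>, t)"
      by (cases z)
    obtain p' u' \<omega>' t' where z': "z' = (p', u', \<omega>', t')"
      by (cases z')
    obtain q v where T: "T_DRS x y (p, u) = (q, v)"
      by force
    obtain q' v' where T': "T_DRS x y (p', u') = (q', v')"
      by force
    have "norm ((q, v) - (q', v')) \<le> norm ((p, u) - (p', u'))"
      using nonexpansive_T_DRS[of x y] unfolding nonexpansive_def T[symmetric] T'[symmetric] by blast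
    then have "(norm (q - q'))\<^sup>2 + (norm (v - v'))\<^sup>2 \<le> (norm (p - p'))\<^sup>2 + (norm (u - u'))\<^sup>2"
      by (simp add: norm_Pair)
    then show ?thesis
      by (simp add: z z' R_def T T' norm_Pair)
  qed
  \<comment> \<open>\<open>R\<close> is the identity on the last two components, so relaxation
    leaves them unchanged as well.\<close>
  moreover have "T_DRS_relaxed x y \<alpha> z = (1 - \<alpha>) *\<^sub>R z + \<alpha> *\<^sub>R R z" for z
    by (simp add: T_DRS_relaxed_def R_def split_beta Let_def prod_eq_iff algebra_simps)
  ultimately show ?thesis
    unfolding averaged_nonexpansive_def nonexpansive_def using assms by blast
qed

lemma relaxation_eq_self_iff:
  fixes v w :: "'a::real_vector"
  assumes "0 < \<alpha>"
  shows "(1 - \<alpha>) *\<^sub>R v + \<alpha> *\<^sub>R w = v \<longleftrightarrow> w = v"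
proof -
  have "(1 - \<alpha>) *\<^sub>R v + \<alpha> *\<^sub>R w - v = \<alpha> *\<^sub>R (w - v)"
    by (simp add: algebra_simps)
  then have "(1 - \<alpha>) *\<^sub>R v + \<alpha> *\<^sub>R w - v = 0 \<longleftrightarrow> w - v = 0"
    using assms by simp
  then show ?thesis
    by simp
qed

lemma Fix_T_DRS_relaxed:
  assumes "0 < \<alpha>"
  shows "Fix (T_DRS_relaxed x y \<alpha>) = {(p, u, \<omega>, t). (p, u) \<in> Fix (T_DRS x y)}"
proof -
  have "(p, u, \<omega>, t) \<in> Fix (T_DRS_relaxed x y \<alpha>) \<longleftrightarrow> (p, u) \<in> Fix (T_DRS x y)" for p u \<omega> t
  proof -
    obtain q v where "T_DRS x y (p, u) = (q, v)"
      by force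
    then show ?thesis
      by (simp add: Fix_def T_DRS_relaxed_def relaxation_eq_self_iff[OF assms])
  qed
  then show ?thesis
    by auto
qed

lemma averaged_nonexpansive_T_op:
  assumes "0 \<le> \<rho>1" "0 \<le> \<rho>2" "0 \<le> \<rho>3" "0 \<le> \<rho>4" "0 < \<alpha>" "\<alpha> < 1"
  shows "averaged_nonexpansive (T_op x y \<rho>1 \<rho>2 \<rho>3 \<rho>4 qs \<alpha>)"
  unfolding T_op_def using assms
  by (intro averaged_nonexpansive_comp averaged_nonexpansive_fold averaged_nonexpansive_closest_point
      averaged_nonexpansive_T_DRS_relaxed B_set_closed_convex E_set_closed_convex L_set_closed_convex)

lemma bounded_range_T_op:
  assumes "0 \<le> \<rho>1" "0 \<le> \<rho>2" "0 \<le> \<rho>3" "0 \<le> \<rho>4"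
  shows "bounded (range (T_op x y \<rho>1 \<rho>2 \<rho>3 \<rho>4 qs \<alpha>))"
proof -
  have "T_op x y \<rho>1 \<rho>2 \<rho>3 \<rho>4 qs \<alpha> z \<in> B_set \<rho>1 \<rho>2 \<rho>3 \<rho>4" for z
    unfolding T_op_def comp_apply by (intro closest_point_in_set B_set_closed_convex assms)
  then show ?thesis
    using bounded_subset[OF bounded_B_set] by blast
qed

text \<open>A point of \<open>F_set\<close> is fixed by every factor. This is the common fixed point
  that \<open>Fix_comp\<close> and \<open>Fix_fold\<close> require at each stage of the
  composition.\<close>

lemma Fix_T_op:
  fixes x :: "'m::finite \<Rightarrow> real ^ 'n::finite" and y :: "'m \<Rightarrow> 'k::{card2,linorder}"
  assumes \<rho>: "0 \<le> \<rho>1" "0 \<le> \<rho>2" "0 \<le> \<rho>3" "0 \<le> \<rho>4" and \<alpha>: "0 < \<alpha>" "\<alpha> < 1"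
    and qs: "set qs = UNIV" and ne: "F_set x y \<rho>1 \<rho>2 \<rho>3 \<rho>4 \<noteq> {}"
  shows "Fix (T_op x y \<rho>1 \<rho>2 \<rho>3 \<rho>4 qs \<alpha>) = F_set x y \<rho>1 \<rho>2 \<rho>3 \<rho>4"
proof -
  let ?B = "B_set \<rho>1 \<rho>2 \<rho>3 \<rho>4" and ?D = "Fix (T_DRS_relaxed x y \<alpha>)"
  let ?E = "\<Inter>q. E_set q :: ('n, 'k, 'm) H set" and ?L = "\<Inter>q. L_set x y q"
  have F: "F_set x y \<rho>1 \<rho>2 \<rho>3 \<rho>4 = ?D \<inter> ?B \<inter> (?E \<inter> ?L)"
    unfolding F_set_def Fix_T_DRS_relaxed[OF \<alpha>(1)] by auto
  note av = averaged_nonexpansive_comp averaged_nonexpansive_fold averaged_nonexpansive_closest_point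
    averaged_nonexpansive_T_DRS_relaxed B_set_closed_convex E_set_closed_convex L_set_closed_convex
  have B: "Fix (closest_point ?B) = ?B"
    by (intro Fix_closest_point B_set_closed_convex \<rho>)
  obtain z where z: "z \<in> ?D" "z \<in> ?B" "z \<in> ?E" "z \<in> ?L"
    using ne unfolding F by blast
  let ?fE = "fold (\<lambda>q. closest_point (E_set q :: ('n, 'k, 'm) H set)) qs"
  let ?fL = "fold (\<lambda>q. closest_point (L_set x y q)) qs"
  have fE: "Fix (closest_point (E_set q)) = (E_set q :: ('n, 'k, 'm) H set)" for q
    by (intro Fix_closest_point E_set_closed_convex)
  have fL: "Fix (closest_point (L_set x y q)) = L_set x y q" for q
    by (intro Fix_closest_point L_set_closed_convex)
  have "Fix ?fE = (\<Inter>q\<in>set qs. Fix (closest_point (E_set q :: ('n, 'k, 'm) H set)))"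
    using z(3) by (intro Fix_fold av) (auto simp only: fE)
  then have E: "Fix ?fE = ?E"
    by (simp only: fE qs)
  have "Fix ?fL = (\<Inter>q\<in>set qs. Fix (closest_point (L_set x y q)))"
    using z(4) by (intro Fix_fold av) (auto simp only: fL)
  then have L: "Fix ?fL = ?L"
    by (simp only: fL qs)
  have "?B \<inter> ?D \<noteq> {}"
    using z by blast
  then have BD: "Fix (closest_point ?B \<circ> T_DRS_relaxed x y \<alpha>) = ?B \<inter> ?D"
    using Fix_comp[of "closest_point ?B" "T_DRS_relaxed x y \<alpha>"] \<rho> \<alpha> by (simp only: B av True_implies_equals not_False_eq_True)
  have "?B \<inter> ?D \<inter> ?E \<noteq> {}"
    using z by blast
  then have BDE: "Fix (closest_point ?B \<circ> T_DRS_relaxed x y \<alpha> \<circ> ?fE) = ?B \<inter> ?D \<inter> ?E"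
    using Fix_comp[of "closest_point ?B \<circ> T_DRS_relaxed x y \<alpha>" ?fE] \<rho> \<alpha> by (simp only: BD E av True_implies_equals not_False_eq_True)
  have "?B \<inter> ?D \<inter> ?E \<inter> ?L \<noteq> {}"
    using z by blast
  then have "Fix (T_op x y \<rho>1 \<rho>2 \<rho>3 \<rho>4 qs \<alpha>) = ?B \<inter> ?D \<inter> ?E \<inter> ?L"
    using Fix_comp[of "closest_point ?B \<circ> T_DRS_relaxed x y \<alpha> \<circ> ?fE" ?fL] \<rho> \<alpha>
    unfolding T_op_def by (simp only: BDE L av True_implies_equals not_False_eq_True)
  then show ?thesis
    unfolding F by blast
qed

text \<open>At a fixed point the projection of \<open>(p, u)\<close> keeps \<open>p\<close>, so the
  sets \<open>L_set\<close> determine \<open>\<omega>\<close> and the sets \<open>E_set\<close>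
  merge into \<open>Psi p \<le> t\<close>.\<close>

lemma F_set_iff:
  "(p, u, \<omega>, t) \<in> F_set x y \<rho>1 \<rho>2 \<rho>3 \<rho>4 \<longleftrightarrow>
     dual_certificate x y p (margin_map x y p - u) \<and>
     (\<forall>q. \<omega> $ q = weight p (pair_fst q) - weight p (pair_snd q)) \<and> Psi p \<le> t \<and>
     norm p \<le> \<rho>1 \<and> norm u \<le> \<rho>2 \<and> norm \<omega> \<le> \<rho>3 \<and> - \<rho>4 \<le> t \<and> t \<le> \<rho>4"
proof (cases "dual_certificate x y p (margin_map x y p - u)")
  case True
  have "(\<forall>q. norm (\<omega> $ q) \<le> t \<and> \<omega> $ q = weight p (pair_fst q) - weight p (pair_snd q)) \<longleftrightarrow>
      (\<forall>q. \<omega> $ q = weight p (pair_fst q) - weight p (pair_snd q)) \<and> Psi p \<le> t"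
    unfolding Psi_le_iff by metis
  then show ?thesis
    using True
    by (auto simp: F_set_def Fix_T_DRS_iff B_set_def E_set_def L_set_def closest_point_null_A[OF True]
      Omega_op_def)
qed (simp add: F_set_def Fix_T_DRS_iff)

lemma norm_diff_orthogonal_power2:
  fixes v w :: "'a::real_inner"
  assumes "v \<bullet> w = 0"
  shows "(norm (w - v))\<^sup>2 = (norm w)\<^sup>2 + (norm v)\<^sup>2"
  using assms unfolding power2_norm_eq_inner by (simp add: inner_simps inner_commute)

lemma F_setI:
  fixes x :: "'m::finite \<Rightarrow> real ^ 'n::finite" and y :: "'m \<Rightarrow> 'k::{card2,linorder}"
  assumes v: "dual_certificate x y p v" and p: "norm p \<le> \<rho>1"
    and \<rho>2: "0 \<le> \<rho>2" "(norm (margin_map x y p))\<^sup>2 + (norm v)\<^sup>2 \<le> \<rho>2\<^sup>2"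
    and \<rho>3: "\<rho>3 = \<rho>1 * real CARD('k) * (real CARD('k) - 1)" and \<rho>4: "\<rho>4 = 2 * \<rho>1"
  shows "(p, margin_map x y p - v, (\<chi> q. weight p (pair_fst q) - weight p (pair_snd q)), Psi p)
    \<in> F_set x y \<rho>1 \<rho>2 \<rho>3 \<rho>4"
proof -
  let ?\<omega> = "(\<chi> q. weight p (pair_fst q) - weight p (pair_snd q)) :: ('n, 'k) H3"
  have w: "norm (weight p r - weight p s) \<le> 2 * \<rho>1" for r s
    using norm_weight_diff_le[of p r s] p by linarith
  have "(norm (margin_map x y p - v))\<^sup>2 \<le> \<rho>2\<^sup>2"
    using v \<rho>2(2) norm_diff_orthogonal_power2[of v "margin_map x y p"]
    unfolding dual_certificate_def by auto
  then have "norm (margin_map x y p - v) \<le> \<rho>2"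
    using \<rho>2(1) by (rule power2_le_imp_le)
  moreover have "norm ?\<omega> \<le> \<rho>3"
  proof -
    \<comment> \<open>The sum of the norms suffices: K (K - 1) / 2 entries of norm at most
      \<open>2 * \<rho>1\<close> add up to at most \<open>\<rho>3\<close>.\<close>
    have "norm ?\<omega> \<le> (\<Sum>q\<in>UNIV. norm (?\<omega> $ q))"
      unfolding norm_vec_def by (intro L2_set_le_sum) simp
    also have "\<dots> \<le> (\<Sum>q\<in>(UNIV :: 'k label_pair set). 2 * \<rho>1)"
      using w by (intro sum_mono) simp
    also have "\<dots> = (2 * real CARD('k label_pair)) * \<rho>1"
      by simp
    also have "2 * real CARD('k label_pair) = real CARD('k) * (real CARD('k) - 1)"
      using arg_cong[OF two_card_label_pair[where 'k = 'k], of real]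
      by (simp add: algebra_simps power2_eq_square)
    finally show ?thesis
      by (simp add: \<rho>3 mult_ac)
  qed
  moreover have "Psi p \<le> \<rho>4"
    using w by (simp add: Psi_le_iff \<rho>4)
  moreover have "- \<rho>4 \<le> Psi p"
    using Psi_nonneg[of p] p norm_ge_zero[of p] unfolding \<rho>4 by linarith
  ultimately show ?thesis
    using v p by (simp add: F_set_iff)
qed

text \<open>
  If \<open>0\<close> is not a minimizer, then \<open>A p\<close> has an entry \<open>\<le> - 1\<close>, which bounds \<open>\<rho>1\<close> from below and leaves enough room for the dual part of the second component.
\<close>

lemma feasible_point:
  fixes x :: "'m::finite \<Rightarrow> real ^ 'n::finite" and y :: "'m \<Rightarrow> 'k::{card2,linorder}"
  assumes x: "\<forall>i. norm (x i) \<le> \<Upsilon>" and \<rho>1: "0 < \<rho>1"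
    and p: "p \<in> argmin_set Psi (hinge_minimizers x y)" "norm p \<le> \<rho>1"
    and \<rho>2: "\<rho>2 = 2 * \<rho>1 * sqrt (real CARD('k) * real CARD('m) * (\<Upsilon>\<^sup>2 + 1))"
    and \<rho>3: "\<rho>3 = \<rho>1 * real CARD('k) * (real CARD('k) - 1)" and \<rho>4: "\<rho>4 = 2 * \<rho>1"
    and 0: "0 \<in> hinge_minimizers x y \<Longrightarrow> \<exists>v. dual_certificate x y 0 v \<and> norm v \<le> \<rho>2"
  obtains z where "z \<in> F_set x y \<rho>1 \<rho>2 \<rho>3 \<rho>4" "\<And>q. q \<in> hinge_minimizers x y \<Longrightarrow> Theta z \<le> Psi q"
proof (cases "0 \<in> hinge_minimizers x y")
  case True
  then obtain v where v: "dual_certificate x y 0 v" "norm v \<le> \<rho>2"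
    using 0 by blast
  have "0 \<le> \<rho>2"
    using v(2) norm_ge_zero order_trans by blast
  moreover have "(norm (margin_map x y 0))\<^sup>2 + (norm v)\<^sup>2 \<le> \<rho>2\<^sup>2"
    using v(2) by (simp add: linear_0[OF linear_margin_map] power_mono)
  moreover have "norm (0 :: ('n, 'k) H1) \<le> \<rho>1"
    using \<rho>1 by simp
  ultimately have F: "(0, margin_map x y 0 - v,
      (\<chi> q. weight 0 (pair_fst q) - weight 0 (pair_snd q)), Psi (0 :: ('n, 'k) H1))
      \<in> F_set x y \<rho>1 \<rho>2 \<rho>3 \<rho>4"
    by (intro F_setI v(1) \<rho>3 \<rho>4)
  have "Psi (0 :: ('n, 'k) H1) \<le> 0"
    by (simp add: Psi_le_iff)
  then have "Psi (0 :: ('n, 'k) H1) \<le> Psi q" for q :: "('n, 'k) H1"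
    using Psi_nonneg[of q] by linarith
  then show thesis
    by (intro that[OF F]) (simp add: Theta_def)
next
  case False
  \<comment> \<open>The unit of the norm budget \<open>\<rho>2\<^sup>2 = 4 * Q\<close>: the margins
    of \<open>p\<close> take at most \<open>2 * Q\<close>, and \<open>v\<close> at most
    \<open>Q\<close>.\<close>
  define Q where "Q = real CARD('k) * real CARD('m) * (\<Upsilon>\<^sup>2 + 1) * \<rho>1\<^sup>2"
  have pm: "p \<in> hinge_minimizers x y"
    using p by (simp add: argmin_set_iff)
  obtain v where v: "dual_certificate x y p v"
    using minimizer_imp_dual_certificate[OF pm] .
  have K: "2 \<le> real CARD('k)"
    using of_nat_mono[OF two_le_card[where 'a = 'k], where 'a = real] by simp
  have p2: "(norm p)\<^sup>2 \<le> \<rho>1\<^sup>2"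
    using p(2) by (simp add: power_mono)
  have "(norm (margin_map x y p))\<^sup>2 \<le> 2 * (real CARD('k) * real CARD('m) * (\<Upsilon>\<^sup>2 + 1) * (norm p)\<^sup>2)"
    using x by (intro norm_margin_map_power2_le) simp
  also have "\<dots> \<le> 2 * Q"
    unfolding Q_def using p2 by (intro mult_left_mono) auto
  finally have A: "(norm (margin_map x y p))\<^sup>2 \<le> 2 * Q" .
  obtain i where i: "\<And>j. j \<noteq> y i \<Longrightarrow> margin_map x y p $ i $ j \<le> - 1"
    using minimizer_margin_le_minus_1[OF pm False] by blast
  obtain r s :: 'k where "r < s"
    using ex_label_pair[where 'k = 'k] by auto
  then have "r \<noteq> y i \<or> s \<noteq> y i"
    by auto
  then obtain j where "j \<noteq> y i"
    by blast
  then have "1 \<le> - (margin_map x y p $ i $ j)"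
    using i by force
  then have "1\<^sup>2 \<le> (- (margin_map x y p $ i $ j))\<^sup>2"
    by (intro power_mono) auto
  also have "\<dots> \<le> 2 * (norm p)\<^sup>2 * (\<Upsilon>\<^sup>2 + 1)"
    using margin_map_nth_power2_le[of x i \<Upsilon> y p j] x by simp
  also have "\<dots> \<le> 2 * \<rho>1\<^sup>2 * (\<Upsilon>\<^sup>2 + 1)"
    using p2 by (intro mult_right_mono) auto
  \<comment> \<open>The factor 2 is at most K; multiplying the chain by M then gives
    \<open>real CARD('m) \<le> Q\<close>.\<close>
  also have "\<dots> \<le> real CARD('k) * \<rho>1\<^sup>2 * (\<Upsilon>\<^sup>2 + 1)"
    using K by (intro mult_right_mono) auto
  finally have "real CARD('m) * 1 \<le> real CARD('m) * (real CARD('k) * \<rho>1\<^sup>2 * (\<Upsilon>\<^sup>2 + 1))"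
    by (intro mult_left_mono) auto
  then have M: "real CARD('m) \<le> Q"
    by (simp add: Q_def mult_ac)
  have "(norm v)\<^sup>2 \<le> (sqrt (real CARD('m)))\<^sup>2"
    using norm_dual_certificate[OF v] by (intro power_mono) auto
  then have "(norm v)\<^sup>2 \<le> Q"
    using M by simp
  moreover have "\<rho>2\<^sup>2 = 4 * Q"
    by (simp add: \<rho>2 Q_def power_mult_distrib mult_ac)
  ultimately have "(norm (margin_map x y p))\<^sup>2 + (norm v)\<^sup>2 \<le> \<rho>2\<^sup>2"
    using A M of_nat_0_le_iff[of "CARD('m)", where 'a = real] by linarith
  moreover have "0 \<le> \<rho>2"
    using \<rho>1 by (simp add: \<rho>2)
  ultimately have "(p, margin_map x y p - v,
      (\<chi> q. weight p (pair_fst q) - weight p (pair_snd q)), Psi p) \<in> F_set x y \<rho>1 \<rho>2 \<rho>3 \<rho>4"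
    by (intro F_setI v p(2) \<rho>3 \<rho>4)
  then show thesis
    by (rule that) (use p(1) in \<open>simp add: Theta_def argmin_set_iff\<close>)
qed

lemma Theta_eq_inner: "Theta z = z \<bullet> (0, 0, 0, 1)"
  by (cases z) (simp add: Theta_def)

text \<open>\<open>grad\<close> is a definite description, so uniqueness of the gradient is shown
  too, by evaluating the derivative at \<open>D - e\<close>. For \<open>Theta\<close> the gradient
  is the constant vector \<open>(0, 0, 0, 1)\<close>.\<close>

lemma grad_inner: "grad (\<lambda>v. v \<bullet> e) v = e"
  unfolding grad_def
proof (rule the_equality)
  show "GDERIV (\<lambda>v. v \<bullet> e) v :> e"
    unfolding gderiv_def by (auto intro!: derivative_eq_intros)
  show "D = e" if "GDERIV (\<lambda>v. v \<bullet> e) v :> D" for D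
  proof -
    have "((\<lambda>v. v \<bullet> e) has_derivative (\<lambda>h. h \<bullet> e)) (at v)"
      by (auto intro!: derivative_eq_intros)
    then have "(\<lambda>h. h \<bullet> D) = (\<lambda>h. h \<bullet> e)"
      using that has_derivative_unique unfolding gderiv_def by blast
    then have "(D - e) \<bullet> D = (D - e) \<bullet> e"
      by metis
    then have "(D - e) \<bullet> (D - e) = 0"
      by (subst inner_diff_right) simp
    then show "D = e"
      by simp
  qed
qed

theorem theorem1:
  fixes x :: "'m::finite \<Rightarrow> real ^ 'n::finite"
    and y :: "'m \<Rightarrow> 'k::{card2,linorder}"
    and \<Upsilon> \<rho>1 \<rho>2 \<rho>3 \<rho>4 :: real
    and qs :: "'k label_pair list"
  assumes "hinge_minimizers x y \<noteq> {}"
    and "0 < \<Upsilon>" and "0 < \<rho>1"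
    and "\<forall>i. norm (x i) \<le> \<Upsilon>"
    and "argmin_set Psi (hinge_minimizers x y) \<inter> cball 0 \<rho>1 \<noteq> {}"
    and "\<rho>2 = 2 * \<rho>1 * sqrt (real CARD('k) * real CARD('m) * (\<Upsilon>\<^sup>2 + 1))"
    and "\<rho>3 = \<rho>1 * real CARD('k) * (real CARD('k) - 1)"
    and "\<rho>4 = 2 * \<rho>1"
    and "pair_enumeration qs"
  shows
    "(\<forall>p u \<omega> t. (p, u, \<omega>, t) \<in> solutions x y \<rho>1 \<rho>2 \<rho>3 \<rho>4 \<longrightarrow>
        p \<in> argmin_set Psi (hinge_minimizers x y)) \<and>
     (\<forall>\<alpha>\<in>{0<..<1}.
        averaged_nonexpansive (T_op x y \<rho>1 \<rho>2 \<rho>3 \<rho>4 qs \<alpha>) \<and>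
        (radius_large_enough x y \<rho>2 \<longrightarrow>
           Fix (T_op x y \<rho>1 \<rho>2 \<rho>3 \<rho>4 qs \<alpha>) = F_set x y \<rho>1 \<rho>2 \<rho>3 \<rho>4)) \<and>
     (radius_large_enough x y \<rho>2 \<longrightarrow>
       (\<forall>\<alpha>\<in>{0<..<1}. \<forall>(lam::nat \<Rightarrow> real) (z::nat \<Rightarrow> ('n, 'k, 'm) H).
        (\<forall>n\<ge>1. 0 \<le> lam n) \<and> lam \<longlonglongrightarrow> 0 \<and>
        filterlim (\<lambda>n. \<Sum>k=1..n. lam k) at_top sequentially \<and>
        (\<forall>n. z (Suc n) =
           T_op x y \<rho>1 \<rho>2 \<rho>3 \<rho>4 qs \<alpha> (z n)
           - lam (Suc n) *\<^sub>R grad Theta (T_op x y \<rho>1 \<rho>2 \<rho>3 \<rho>4 qs \<alpha> (z n)))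
        \<longrightarrow>
        (\<exists>d. (\<forall>n. is_minimum (\<lambda>s. norm (z n - s)) (solutions x y \<rho>1 \<rho>2 \<rho>3 \<rho>4) (d n)) \<and>
             d \<longlonglongrightarrow> 0) \<and>
        (\<exists>d. (\<forall>n. is_minimum (\<lambda>s. norm (fst (z n) - s))
                    (argmin_set Psi (hinge_minimizers x y) \<inter> cball 0 \<rho>1) (d n)) \<and>
             d \<longlonglongrightarrow> 0)))"
proof -
  let ?S = "hinge_minimizers x y" and ?F = "F_set x y \<rho>1 \<rho>2 \<rho>3 \<rho>4"
  let ?T = "T_op x y \<rho>1 \<rho>2 \<rho>3 \<rho>4 qs" and ?sol = "solutions x y \<rho>1 \<rho>2 \<rho>3 \<rho>4"
  let ?P = "argmin_set Psi ?S \<inter> cball 0 \<rho>1"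
  have K: "1 \<le> real CARD('k)"
    using two_le_card[where 'a = 'k] by linarith
  have \<rho>: "0 \<le> \<rho>1" "0 \<le> \<rho>2" "0 \<le> \<rho>3" "0 \<le> \<rho>4"
    using assms K by auto
  have qs: "set qs = UNIV"
    using assms by (simp add: pair_enumeration_def)
  obtain p0 where p0: "p0 \<in> argmin_set Psi ?S" "norm p0 \<le> \<rho>1"
    using assms(5) by auto
  note feasible = feasible_point[OF assms(4,3) p0 assms(6-8)]
  have a: "p \<in> argmin_set Psi ?S" if sol: "(p, u, \<omega>, t) \<in> ?sol" for p u \<omega> t
  proof -
    have F: "(p, u, \<omega>, t) \<in> ?F" and min: "\<And>z. z \<in> ?F \<Longrightarrow> t \<le> Theta z"
      using sol by (auto simp: solutions_def argmin_set_iff Theta_def)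
    let ?v = "margin_map x y p - u"
    have v: "dual_certificate x y p ?v" and u: "norm u \<le> \<rho>2" and t: "Psi p \<le> t"
      using F by (auto simp: F_set_iff)
    \<comment> \<open>By orthogonality \<open>?v\<close> is no longer than \<open>u\<close>.
      Transferred to \<open>0\<close> in case \<open>0\<close> is a minimizer, it is the short
      certificate that \<open>feasible\<close> asks for.\<close>
    have "(norm (margin_map x y p - ?v))\<^sup>2 = (norm (margin_map x y p))\<^sup>2 + (norm ?v)\<^sup>2"
      using v by (intro norm_diff_orthogonal_power2) (simp add: dual_certificate_def)
    then have "(norm ?v)\<^sup>2 \<le> (norm u)\<^sup>2"
      by simp
    then have "norm ?v \<le> \<rho>2"
      using u by (meson norm_ge_zero order_trans power2_le_imp_le)
    then obtain z where z: "z \<in> ?F" "\<And>q. q \<in> ?S \<Longrightarrow> Theta z \<le> Psi q"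
      using feasible dual_certificate_transfer[OF v] by metis
    \<comment> \<open>The chain is \<open>Psi p \<le> t \<le> Theta z \<le> Psi q\<close>, with
      \<open>z\<close> the feasible comparison point.\<close>
    have "Psi p \<le> Psi q" if "q \<in> ?S" for q
      using t min[OF z(1)] z(2)[OF that] by linarith
    then show ?thesis
      using dual_certificate_imp_minimizer[OF v] by (simp add: argmin_set_iff)
  qed
  have av: "averaged_nonexpansive (?T \<alpha>)" if "\<alpha> \<in> {0<..<1}" for \<alpha>
    using that by (intro averaged_nonexpansive_T_op \<rho>) auto
  have F_ne: "?F \<noteq> {}" if R: "radius_large_enough x y \<rho>2"
  proof -
    have "\<exists>v. dual_certificate x y 0 v \<and> norm v \<le> \<rho>2" if "0 \<in> ?S"
      using that R minimizer_imp_dual_certificate[OF that] norm_dual_certificate order_trans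
      unfolding radius_large_enough_def by metis
    then show ?thesis
      using feasible by blast
  qed
  have Fix: "Fix (?T \<alpha>) = ?F" if "radius_large_enough x y \<rho>2" "\<alpha> \<in> {0<..<1}" for \<alpha>
    using that F_ne by (intro Fix_T_op \<rho> qs) auto
  have c: "(\<exists>d. (\<forall>n. is_minimum (\<lambda>s. norm (z n - s)) ?sol (d n)) \<and> d \<longlonglongrightarrow> 0) \<and>
      (\<exists>d. (\<forall>n. is_minimum (\<lambda>s. norm (fst (z n) - s)) ?P (d n)) \<and> d \<longlonglongrightarrow> 0)"
    if R: "radius_large_enough x y \<rho>2" and \<alpha>: "\<alpha> \<in> {0<..<1}"
      and lam: "\<forall>n\<ge>1. 0 \<le> lam n" "lam \<longlonglongrightarrow> 0"
        "filterlim (\<lambda>n. \<Sum>k=1..n. lam k) at_top sequentially"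
      and z: "\<forall>n. z (Suc n) = ?T \<alpha> (z n) - lam (Suc n) *\<^sub>R grad Theta (?T \<alpha> (z n))"
    for \<alpha> and lam :: "nat \<Rightarrow> real" and z :: "nat \<Rightarrow> ('n, 'k, 'm) H"
  proof -
    have \<Theta>: "Theta = (\<lambda>v :: ('n, 'k, 'm) H. v \<bullet> (0, 0, 0, 1))"
      by (rule ext) (rule Theta_eq_inner)
    have sol: "?sol = argmin_set (\<lambda>v. v \<bullet> (0, 0, 0, 1)) (Fix (?T \<alpha>))"
      by (simp add: solutions_def \<Theta> Fix[OF R \<alpha>])
    have bdd: "bounded (range (?T \<alpha>))"
      by (intro bounded_range_T_op \<rho>)
    have cont: "continuous_on UNIV (\<lambda>v :: ('n, 'k, 'm) H. v \<bullet> (0, 0, 0, 1))"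
      by (intro continuous_intros)
    have cF: "compact (Fix (?T \<alpha>))"
      by (intro compact_Fix averaged_nonexpansive_imp_nonexpansive av \<alpha> bdd)
    have ne: "Fix (?T \<alpha>) \<noteq> {}"
      using F_ne[OF R] Fix[OF R \<alpha>] by simp
    have S: "closed ?sol" "?sol \<noteq> {}"
      unfolding sol using compact_argmin_set[OF cF cont] argmin_set_nonempty[OF cF cont ne]
      by (auto intro: compact_imp_closed)
    have P: "closed ?P" "?P \<noteq> {}"
      using assms(5) by (auto intro!: closed_Int closed_argmin_set closed_hinge_minimizers continuous_on_Psi)
    have lim: "(\<lambda>n. infdist (z n) ?sol) \<longlonglongrightarrow> 0"
      unfolding sol
      by (rule hybrid_steepest_descent[OF av[OF \<alpha>] bdd ne, where lam = lam])
        (use lam z in \<open>auto simp: \<Theta> grad_inner\<close>)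
    \<comment> \<open>Part (a) and the ball constraint send solutions into \<open>?P\<close> under
      \<open>fst\<close>, which does not increase distances.\<close>
    have le: "infdist (fst (z n)) ?P \<le> infdist (z n) ?sol" for n
    proof -
      obtain s where s: "s \<in> ?sol" "infdist (z n) ?sol = dist (z n) s"
        using infdist_attains_inf[OF S] by blast
      obtain p u \<omega> t where s_eq: "s = (p, u, \<omega>, t)"
        by (cases s)
      have "norm p \<le> \<rho>1"
        using s(1) by (simp add: s_eq solutions_def argmin_set_iff F_set_iff)
      then have "fst s \<in> ?P"
        using a s(1) by (simp add: s_eq)
      then have "infdist (fst (z n)) ?P \<le> dist (fst (z n)) (fst s)"
        by (rule infdist_le)
      also have "\<dots> \<le> dist (z n) s"
        by (rule dist_fst_le)
      finally show ?thesis
        by (simp add: s)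
    qed
    have "(\<lambda>n. infdist (fst (z n)) ?P) \<longlonglongrightarrow> 0"
      by (rule tendsto_sandwich[OF _ _ tendsto_const lim]) (auto simp: infdist_nonneg le)
    then have "\<exists>d. (\<forall>n. is_minimum (\<lambda>s. norm (fst (z n) - s)) ?P (d n)) \<and> d \<longlonglongrightarrow> 0"
      by (intro exI[of _ "\<lambda>n. infdist (fst (z n)) ?P"]) (simp add: is_minimum_infdist[OF P])
    moreover have "\<exists>d. (\<forall>n. is_minimum (\<lambda>s. norm (z n - s)) ?sol (d n)) \<and> d \<longlonglongrightarrow> 0"
      using lim by (intro exI[of _ "\<lambda>n. infdist (z n) ?sol"]) (simp add: is_minimum_infdist[OF S])
    ultimately show ?thesis
      by blast
  qed
  show ?thesis
    using a av Fix c by blast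
qed

end
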